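(* Let $d\ge1$ and let $\ell\geq 1$ be an integer. For $\mu,\nu\in\mathcal{M}_+(\mathbb{R}^d)$ let $$D_\ell(\mu,\nu):=\sup\left\{\left|\int_{\mathbb{R}^d}\phi\,d\mu-\int_{\mathbb{R}^d}\phi\,d\nu\right| : \phi\in C_0^\ell(\mathbb{R}^d),\ \|\phi\|_{C^\ell}\le1\right\}.$$ Then: (1) $D_\ell$ is a distance over $\mathcal{M}_+(\mathbb{R}^d)$; (2) $D_\ell$ is a complete metric on $\mathcal{M}_+(\mathbb{R}^d)$ that metrizes narrow convergence. In particular, $(\mathcal{P}(\mathbb{R}^d),D_\ell)$ is a complete and separable metric space; (3) there exists a countable subset $\mathcal{S}_\ell\subset C_c^\ell(\mathbb{R}^d)$ satisfying $\|\phi\|_{C^\ell}\le1$ for every $\phi\in\mathcal{S}_\ell$, which is dense in the unit ball of $(C_0^\ell(\mathbb{R}^d),\|\cdot\|_{C^\ell})$ and such that, for all $\mu,\nu\in\mathcal{M}_+(\mathbb{R}^d)$, $$D_\ell(\mu,\nu)=\sup\left\{\left|\int_{\mathbb{R}^d}\phi\,d\mu-\int_{\mathbb{R}^d}\phi\,d\nu\right| : \phi\in\mathcal{S}_\ell\right\}.$$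
   Context: $\mathcal{M}_+(\mathbb{R}^d)$ is the set of finite non-negative Borel measures on $\mathbb{R}^d$, $\mathcal{P}(\mathbb{R}^d)$ the subset of probability measures; narrow convergence is convergence of integrals against all bounded continuous functions. $C_0^\ell(\mathbb{R}^d)$ is the set of $\phi\in C^\ell(\mathbb{R}^d)$ such that $\phi$ and all its derivatives of order at most $\ell$ tend to $0$ as $|x|\to\infty$; $\|\phi\|_{C^\ell}=\max_{j=0,\dots,\ell}\sup_{x}|\nabla^{\otimes_j}\phi(x)|$, where $|\nabla^{\otimes_j}\phi(x)|$ is the Euclidean ($2$-)norm of all entries of the tensor of $j$-th order derivatives. $C_c^\ell$ denotes compactly supported $C^\ell$ functions. The unit ball is closed. *)

theory Defs
  imports "HOL-Probability.Probability"
begin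

definition partial_deriv :: "'n::finite \<Rightarrow> (real^'n \<Rightarrow> real) \<Rightarrow> real^'n \<Rightarrow> real" where
  "partial_deriv i f x = frechet_derivative f (at x) (axis i 1)"

text \<open>A list of \<open>j\<close> indices is a position in the tensor of \<open>j\<close>-th order derivatives;
  the last index of the list is differentiated first.\<close>

primrec partial_derivs :: "'n::finite list \<Rightarrow> (real^'n \<Rightarrow> real) \<Rightarrow> real^'n \<Rightarrow> real" where
  "partial_derivs [] f = f"
| "partial_derivs (i # is) f = partial_deriv i (partial_derivs is f)"

definition C_space :: "nat \<Rightarrow> (real^'n::finite \<Rightarrow> real) set" where
  "C_space l = {f.
     (\<forall>is. length is < l \<longrightarrow> (\<forall>x. partial_derivs is f differentiable (at x))) \<and>
     (\<forall>is. length is \<le> l \<longrightarrow> continuous_on UNIV (partial_derivs is f))}"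

definition C0_space :: "nat \<Rightarrow> (real^'n::finite \<Rightarrow> real) set" where
  "C0_space l = {f \<in> C_space l.
     \<forall>is. length is \<le> l \<longrightarrow> (partial_derivs is f \<longlongrightarrow> 0) at_infinity}"

definition Cc_space :: "nat \<Rightarrow> (real^'n::finite \<Rightarrow> real) set" where
  "Cc_space l = {f \<in> C_space l. compact (closure {x. f x \<noteq> 0})}"

definition deriv_tensor_norm :: "nat \<Rightarrow> (real^'n::finite \<Rightarrow> real) \<Rightarrow> real^'n \<Rightarrow> real" where
  "deriv_tensor_norm j f x = sqrt (\<Sum>is | length is = j. (partial_derivs is f x)\<^sup>2)"

text \<open>The supremum is that of \<open>real\<close>, meaningful only if the derivatives up to order \<open>l\<close>
  are bounded, as they are for functions in \<open>C0_space l\<close>.\<close>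

definition C_norm :: "nat \<Rightarrow> (real^'n::finite \<Rightarrow> real) \<Rightarrow> real" where
  "C_norm l f = Max ((\<lambda>j. SUP x. deriv_tensor_norm j f x) ` {0..l})"

definition C0_unit_ball :: "nat \<Rightarrow> (real^'n::finite \<Rightarrow> real) set" where
  "C0_unit_ball l = {f \<in> C0_space l. C_norm l f \<le> 1}"

definition finite_borel_measures :: "(real^'n::finite) measure set" where
  "finite_borel_measures = {\<mu>. finite_measure \<mu> \<and> sets \<mu> = sets borel}"

definition borel_prob_measures :: "(real^'n::finite) measure set" where
  "borel_prob_measures = {\<mu>. prob_space \<mu> \<and> sets \<mu> = sets borel}"

definition integral_gap ::
    "(real^'n::finite) measure \<Rightarrow> (real^'n) measure \<Rightarrow> (real^'n \<Rightarrow> real) \<Rightarrow> real" where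
  "integral_gap \<mu> \<nu> \<phi> = \<bar>(\<integral>x. \<phi> x \<partial>\<mu>) - (\<integral>x. \<phi> x \<partial>\<nu>)\<bar>"

text \<open>The value \<open>0\<close> outside the finite Borel measures is a totalization: the locale
  \<open>Metric_space M d\<close> demands non-negativity and symmetry of \<open>d\<close> off the carrier \<open>M\<close> too.\<close>

definition D_dist :: "nat \<Rightarrow> (real^'n::finite) measure \<Rightarrow> (real^'n) measure \<Rightarrow> real" where
  "D_dist l \<mu> \<nu> =
     (if \<mu> \<in> finite_borel_measures \<and> \<nu> \<in> finite_borel_measures
      then SUP \<phi>\<in>C0_unit_ball l. integral_gap \<mu> \<nu> \<phi> else 0)"

text \<open>Narrow convergence along an arbitrary filter; sequences are the case
  \<open>F = sequentially\<close>.\<close>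

definition narrow_limit ::
    "('i \<Rightarrow> (real^'n::finite) measure) \<Rightarrow> (real^'n) measure \<Rightarrow> 'i filter \<Rightarrow> bool" where
  "narrow_limit X \<mu> F \<longleftrightarrow>
     (\<forall>\<phi> :: real^'n \<Rightarrow> real. continuous_on UNIV \<phi> \<and> bounded (range \<phi>) \<longrightarrow>
        ((\<lambda>i. \<integral>x. \<phi> x \<partial>X i) \<longlongrightarrow> (\<integral>x. \<phi> x \<partial>\<mu>)) F)"

end

theory Submission
  imports Defs
begin

text \<open>The cutoffs \<open>x \<mapsto> (1 - |c x|\<^sup>2)\<^sub>+\<^sup>m\<close> with \<open>c \<rightarrow> 0\<close> have \<open>C\<^sup>l\<close>-norms bounded uniformly in \<open>c\<close>, so the
  metric controls the difference of total masses. Together with the Weierstrass theorem (a cutoff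
  times a polynomial is an admissible test function up to a constant) this turns convergence in the
  metric into narrow convergence. Conversely the test functions are uniformly Lipschitz, so on a large
  ball they are approximated simultaneously with finitely many continuous functions. For completeness,
  a Cauchy sequence has bounded mass, hence a vague limit point, and tests against functions vanishing
  at infinity see only vague limits. Vague compactness is reduced to Helly's theorem on the
  line with a space-filling curve.\<close>

section \<open>Iterated partial derivatives\<close>

text \<open>The obstacle is escape of mass: test functions vanish at infinity, so a limit taken
  along them may be too small. It is excluded because derivatives of order \<open>j\<close> of a
  function rescaled by \<open>c \<le> 1\<close> carry a factor \<open>c^j \<le> 1\<close>: all the
  cutoffs lie in one multiple of the unit ball, and the constant 1 is a pointwise limit of them.
  Narrow convergence thus amounts to vague convergence plus convergence of masses. The reduction to
  the line uses a continuous curve \<open>g\<close> and a Borel right inverse \<open>s\<close> of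
  it. Measures travel to [0,1] through \<open>s\<close>, which asks for measurability; test
  functions travel through \<open>g\<close>, which keeps them continuous. The order
  \<open>l \<ge> 1\<close> supplies the gradient bound that makes the test functions uniformly
  Lipschitz. The supremum in \<open>C_norm\<close> is one of reals, hence informative only for
  bounded derivatives. Estimates are therefore made with the entrywise predicate
  \<open>derivs_bounded\<close>, which passes through sums and products by induction on the order
  and agrees with \<open>C_norm\<close> up to the number of index lists.\<close>

lemma partial_deriv_eq:
  assumes "(f has_derivative f') (at x)"
  shows "partial_deriv i f x = f' (axis i 1)"
  using assms frechet_derivative_at unfolding partial_deriv_def by metis

lemma partial_derivs_append: "partial_derivs (is @ js) f = partial_derivs is (partial_derivs js f)"
  by (induction "is") auto

lemma partial_derivs_snoc [simp]: "partial_derivs (is @ [i]) f = partial_derivs is (partial_deriv i f)"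
  by (simp add: partial_derivs_append)

text \<open>The last index is the one differentiated first. Splitting it off turns a claim about
  \<open>f\<close> at order \<open>Suc l\<close> into claims about \<open>f\<close> and its first
  partial derivatives at order \<open>l\<close>, the form needed for induction on the order.\<close>

lemma all_lists_le_Suc:
  "(\<forall>is. length is \<le> Suc l \<longrightarrow> Q is) \<longleftrightarrow> Q [] \<and> (\<forall>i is. length is \<le> l \<longrightarrow> Q (is @ [i]))"
proof (safe, goal_cases)
  case (3 js)
  then show ?case by (cases js rule: rev_cases) auto
qed auto

lemma all_lists_less_Suc:
  "(\<forall>is. length is < Suc l \<longrightarrow> Q is) \<longleftrightarrow> Q [] \<and> (\<forall>i is. length is < l \<longrightarrow> Q (is @ [i]))"
proof (safe, goal_cases)
  case (3 js)
  then show ?case by (cases js rule: rev_cases) auto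
qed auto

lemma finite_lists_le [simp]: "finite {is :: 'n::finite list. length is \<le> l}"
  using finite_lists_length_le[of "UNIV :: 'n set" l] by simp

lemma finite_lists_eq [simp]: "finite {is :: 'n::finite list. length is = l}"
  using finite_lists_length_eq[of "UNIV :: 'n set" l] by simp

lemma C_space_0: "f \<in> C_space 0 \<longleftrightarrow> continuous_on UNIV f"
  by (simp add: C_space_def)

text \<open>Continuity of \<open>f\<close> itself does not appear on the right because
  differentiability yields it. All inductions on the order run through this recursion.\<close>

lemma C_space_Suc:
  "f \<in> C_space (Suc l) \<longleftrightarrow> (\<forall>x. f differentiable (at x)) \<and> (\<forall>i. partial_deriv i f \<in> C_space l)"
proof -
  have "continuous_on UNIV f" if "\<forall>x. f differentiable (at x)"
    using that by (simp add: continuous_at_imp_continuous_on differentiable_imp_continuous_within)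
  then show ?thesis
    unfolding C_space_def mem_Collect_eq all_lists_le_Suc all_lists_less_Suc by auto
qed

lemma C_space_continuous: "f \<in> C_space l \<Longrightarrow> continuous_on UNIV f"
  by (auto simp: C_space_def dest!: spec[of _ "[]"])

lemma C_space_mono: "f \<in> C_space l \<Longrightarrow> k \<le> l \<Longrightarrow> f \<in> C_space k"
  by (auto simp: C_space_def)

lemma C_space_SucD: "f \<in> C_space (Suc l) \<Longrightarrow> f \<in> C_space l"
  by (auto simp: C_space_def)

section \<open>Closure of the spaces of differentiable functions under algebraic operations\<close>

lemma partial_deriv_add:
  assumes "f differentiable (at x)" "g differentiable (at x)"
  shows "partial_deriv i (\<lambda>x. f x + g x) x = partial_deriv i f x + partial_deriv i g x"
proof -
  obtain f' g' where f: "(f has_derivative f') (at x)" and g: "(g has_derivative g') (at x)"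
    using assms unfolding differentiable_def by blast
  show ?thesis
    by (simp only: partial_deriv_eq[OF has_derivative_add[OF f g]] partial_deriv_eq[OF f] partial_deriv_eq[OF g])
qed

lemma partial_deriv_mult:
  assumes "f differentiable (at x)" "g differentiable (at x)"
  shows "partial_deriv i (\<lambda>x. f x * g x) x = f x * partial_deriv i g x + partial_deriv i f x * g x"
proof -
  obtain f' g' where f: "(f has_derivative f') (at x)" and g: "(g has_derivative g') (at x)"
    using assms unfolding differentiable_def by blast
  show ?thesis
    by (simp only: partial_deriv_eq[OF has_derivative_mult[OF f g]] partial_deriv_eq[OF f] partial_deriv_eq[OF g])
qed

lemma partial_deriv_const: "partial_deriv i (\<lambda>x. c) = (\<lambda>x. 0)"
  using partial_deriv_eq[OF has_derivative_const] by blast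

lemma C_space_const: "(\<lambda>x. c) \<in> C_space l"
proof (induction l arbitrary: c)
  case (Suc l)
  then show ?case by (auto simp: C_space_Suc partial_deriv_const)
qed (simp add: C_space_0)

lemma C_space_add:
  "f \<in> C_space l \<Longrightarrow> g \<in> C_space l \<Longrightarrow> (\<lambda>x. f x + g x) \<in> C_space l"
proof (induction l arbitrary: f g)
  case 0
  then show ?case by (auto simp: C_space_0 intro: continuous_on_add)
next
  case (Suc l)
  then have "partial_deriv i (\<lambda>x. f x + g x) = (\<lambda>x. partial_deriv i f x + partial_deriv i g x)" for i
    by (auto simp: C_space_Suc partial_deriv_add)
  with Suc show ?case by (auto simp: C_space_Suc)
qed

lemma C_space_mult:
  "f \<in> C_space l \<Longrightarrow> g \<in> C_space l \<Longrightarrow> (\<lambda>x. f x * g x) \<in> C_space l"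
proof (induction l arbitrary: f g)
  case 0
  then show ?case by (auto simp: C_space_0 intro: continuous_on_mult)
next
  case (Suc l)
  then have "partial_deriv i (\<lambda>x. f x * g x) =
      (\<lambda>x. f x * partial_deriv i g x + partial_deriv i f x * g x)" for i
    by (auto simp: C_space_Suc partial_deriv_mult)
  moreover have "f \<in> C_space l" "g \<in> C_space l"
    using Suc.prems C_space_SucD by auto
  ultimately show ?case using Suc by (auto simp: C_space_Suc intro: C_space_add)
qed

lemma C_space_bounded_linear:
  fixes f :: "real^'n::finite \<Rightarrow> real"
  assumes "bounded_linear f"
  shows "f \<in> C_space l"
proof (cases l)
  case 0
  then show ?thesis by (simp add: C_space_0 assms linear_continuous_on)
next
  case (Suc k)
  have d: "(f has_derivative f) (at x)" for x
    using assms by (rule bounded_linear_imp_has_derivative)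
  then have "partial_deriv i f = (\<lambda>x. f (axis i 1))" for i
    using partial_deriv_eq[OF d] by blast
  then show ?thesis unfolding Suc C_space_Suc using d C_space_const by (auto simp: differentiable_def)
qed

text \<open>Polynomials are generated from linear functions and constants by sums and products. They
  serve twice: inside the cutoff function, and as Weierstrass approximants.\<close>

lemma C_space_real_polynomial:
  fixes p :: "real^'n::finite \<Rightarrow> real"
  shows "real_polynomial_function p \<Longrightarrow> p \<in> C_space l"
  by (induction rule: real_polynomial_function.induct)
    (auto intro: C_space_bounded_linear C_space_const C_space_add C_space_mult)

text \<open>Away from 0 the outer function \<open>t \<mapsto> (max 0 t) ^ Suc m\<close> is locally 0
  or a power. At 0 its difference quotient is at most \<open>\<bar>t\<bar> ^ m\<close>, which tends
  to 0 as \<open>m \<ge> 1\<close>.\<close>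

lemma partial_deriv_pos_part_power:
  assumes p: "p differentiable (at x)" and m: "m \<ge> 1"
  shows "(\<lambda>x. (max 0 (p x)) ^ Suc m) differentiable (at x)"
    and "partial_deriv i (\<lambda>x. (max 0 (p x)) ^ Suc m) x = real (Suc m) * (max 0 (p x)) ^ m * partial_deriv i p x"
proof -
  have D: "((\<lambda>t. (max 0 t) ^ Suc m) has_derivative (\<lambda>h. (real (Suc m) * (max 0 t) ^ m) * h)) (at t)"
    for t :: real
  proof -
    consider "t < 0" | "t = 0" | "t > 0" by linarith
    then show ?thesis
    proof cases
      case 1
      have "((\<lambda>t. 0) has_derivative (\<lambda>h. (real (Suc m) * (max 0 t) ^ m) * h)) (at t)"
        using 1 m by (auto simp: max_def power_0_left)
      then show ?thesis
        by (rule has_derivative_transform_within_open[of _ _ _ _ "{..<0}"]) (use 1 in \<open>auto simp: max_def\<close>)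
    next
      case 2
      have "((\<lambda>h. (max 0 h) ^ Suc m / h) \<longlongrightarrow> 0) (at (0::real))"
      proof (rule Lim_null_comparison)
        show "\<forall>\<^sub>F h in at (0::real). norm ((max 0 h) ^ Suc m / h) \<le> \<bar>h\<bar> ^ m"
          by (intro always_eventually) (auto simp: max_def abs_mult power_abs)
        show "((\<lambda>h::real. \<bar>h\<bar> ^ m) \<longlongrightarrow> 0) (at 0)"
          using m by (intro tendsto_eq_intros) (auto simp: power_0_left)
      qed
      then have "((\<lambda>t. (max 0 t) ^ Suc m) has_field_derivative 0) (at (0::real))"
        by (simp add: has_field_derivative_iff)
      then show ?thesis using 2 m by (simp add: has_field_derivative_def power_0_left lambda_zero)
    next
      case 3
      have "((\<lambda>t. t ^ Suc m) has_derivative (\<lambda>h. (real (Suc m) * (max 0 t) ^ m) * h)) (at t)"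
        using 3 has_field_derivative_imp_has_derivative[OF DERIV_pow[of "Suc m" t UNIV]] by simp
      then show ?thesis
        by (rule has_derivative_transform_within_open[of _ _ _ _ "{0<..}"]) (use 3 in \<open>auto simp: max_def\<close>)
    qed
  qed
  obtain p' where p': "(p has_derivative p') (at x)" using p unfolding differentiable_def by blast
  have *: "((\<lambda>x. (max 0 (p x)) ^ Suc m) has_derivative
      (\<lambda>h. (real (Suc m) * (max 0 (p x)) ^ m) * p' h)) (at x)"
    by (rule has_derivative_compose[OF p' D])
  then show "(\<lambda>x. (max 0 (p x)) ^ Suc m) differentiable (at x)" by (rule differentiableI)
  show "partial_deriv i (\<lambda>x. (max 0 (p x)) ^ Suc m) x = real (Suc m) * (max 0 (p x)) ^ m * partial_deriv i p x"
    using partial_deriv_eq[OF *] partial_deriv_eq[OF p'] by simp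
qed

text \<open>Each derivative lowers the exponent by one; starting above \<open>l\<close>, the
  exponent is still positive after \<open>l\<close> derivatives, so the result is
  continuous.\<close>

lemma C_space_pos_part_power:
  assumes "p \<in> C_space l" "l < m"
  shows "(\<lambda>x. (max 0 (p x)) ^ m) \<in> C_space l"
  using assms
proof (induction l arbitrary: m)
  case 0
  then show ?case by (auto simp: C_space_0 intro!: continuous_intros)
next
  case (Suc l)
  then obtain k where k: "m = Suc k" "k \<ge> 1" "l < k" by (cases m) auto
  have p: "\<And>x. p differentiable (at x)" "\<And>i. partial_deriv i p \<in> C_space l" "p \<in> C_space l"
    using Suc.prems C_space_SucD by (auto simp: C_space_Suc)
  have "partial_deriv i (\<lambda>x. (max 0 (p x)) ^ m) =
      (\<lambda>x. real (Suc k) * (max 0 (p x)) ^ k * partial_deriv i p x)" for i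
    using partial_deriv_pos_part_power(2)[OF p(1) k(2)] k(1) by blast
  then show ?case
    using partial_deriv_pos_part_power(1)[OF p(1) k(2)] k Suc.IH[OF p(3) k(3)] p(2)
    by (auto simp: C_space_Suc intro!: C_space_mult C_space_const)
qed

section \<open>Iterated derivatives of sums, multiples and rescaled functions\<close>

lemma partial_derivs_add:
  assumes "f \<in> C_space l" "g \<in> C_space l" "length is \<le> l"
  shows "partial_derivs is (\<lambda>x. f x + g x) = (\<lambda>x. partial_derivs is f x + partial_derivs is g x)"
  using assms
proof (induction "is" arbitrary: f g l rule: rev_induct)
  case (snoc i js)
  then obtain k where k: "l = Suc k" by (cases l) auto
  then have "partial_deriv i (\<lambda>x. f x + g x) = (\<lambda>x. partial_deriv i f x + partial_deriv i g x)"
    using snoc.prems by (auto simp: C_space_Suc partial_deriv_add)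
  then show ?case
    using snoc.IH[of "partial_deriv i f" k "partial_deriv i g"] snoc.prems k by (auto simp: C_space_Suc)
qed simp

lemma partial_derivs_cmult:
  assumes "f \<in> C_space l" "length is \<le> l"
  shows "partial_derivs is (\<lambda>x. c * f x) = (\<lambda>x. c * partial_derivs is f x)"
  using assms
proof (induction "is" arbitrary: f l rule: rev_induct)
  case (snoc i js)
  then obtain k where k: "l = Suc k" by (cases l) auto
  then have "partial_deriv i (\<lambda>x. c * f x) = (\<lambda>x. c * partial_deriv i f x)"
    using snoc.prems by (auto simp: C_space_Suc partial_deriv_mult partial_deriv_const)
  then show ?case using snoc k by (auto simp: C_space_Suc)
qed simp

lemma partial_deriv_scale:
  assumes "f differentiable (at (c *\<^sub>R x))"
  shows "partial_deriv i (\<lambda>x. f (c *\<^sub>R x)) x = c * partial_deriv i f (c *\<^sub>R x)"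
    and "(\<lambda>x. f (c *\<^sub>R x)) differentiable (at x)"
proof -
  obtain f' where f': "(f has_derivative f') (at (c *\<^sub>R x))" using assms unfolding differentiable_def by blast
  have *: "((\<lambda>x. f (c *\<^sub>R x)) has_derivative (\<lambda>h. f' (c *\<^sub>R h))) (at x)"
    by (rule has_derivative_compose[of "\<lambda>x. c *\<^sub>R x", OF _ f']) (auto intro!: derivative_eq_intros)
  show "(\<lambda>x. f (c *\<^sub>R x)) differentiable (at x)" using * by (rule differentiableI)
  show "partial_deriv i (\<lambda>x. f (c *\<^sub>R x)) x = c * partial_deriv i f (c *\<^sub>R x)"
    using partial_deriv_eq[OF *] partial_deriv_eq[OF f'] linear_cmul[OF has_derivative_linear[OF f']]
    by simp
qed

lemma C_space_scale:
  "f \<in> C_space l \<Longrightarrow> (\<lambda>x. f (c *\<^sub>R x)) \<in> C_space l"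
proof (induction l arbitrary: f)
  case 0
  then show ?case
    by (auto simp: C_space_0 intro!: continuous_on_compose2[of UNIV f UNIV] continuous_intros)
next
  case (Suc l)
  then have "partial_deriv i (\<lambda>x. f (c *\<^sub>R x)) = (\<lambda>x. c * partial_deriv i f (c *\<^sub>R x))" for i
    by (auto simp: C_space_Suc partial_deriv_scale)
  with Suc show ?case
    by (auto simp: C_space_Suc intro!: partial_deriv_scale C_space_mult C_space_const)
qed

lemma partial_derivs_scale:
  assumes "f \<in> C_space l" "length is \<le> l"
  shows "partial_derivs is (\<lambda>x. f (c *\<^sub>R x)) = (\<lambda>x. c ^ length is * partial_derivs is f (c *\<^sub>R x))"
  using assms
proof (induction "is" arbitrary: f l rule: rev_induct)
  case (snoc i js)
  then obtain k where k: "l = Suc k" by (cases l) auto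
  then have f: "\<forall>x. f differentiable (at x)" "partial_deriv i f \<in> C_space k" 
    using snoc.prems by (auto simp: C_space_Suc)
  then have "partial_deriv i (\<lambda>x. f (c *\<^sub>R x)) = (\<lambda>x. c * partial_deriv i f (c *\<^sub>R x))"
    by (auto simp: partial_deriv_scale)
  moreover have "(\<lambda>x. partial_deriv i f (c *\<^sub>R x)) \<in> C_space k" using f C_space_scale by blast
  ultimately show ?case using snoc.IH[OF f(2)] snoc.prems k partial_derivs_cmult[of _ k js c] by (simp add: mult.assoc)
qed simp

text \<open>On the open set each derivative agrees locally with the zero function, so the next one
  vanishes as well. Applied to the complement of the support, it shows that compact support forces
  all derivatives to vanish near infinity.\<close>

lemma partial_derivs_zero_on_open:
  assumes "open U" "\<And>x. x \<in> U \<Longrightarrow> f x = 0" "x \<in> U"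
  shows "partial_derivs is f x = 0"
  using assms(3)
proof (induction "is" arbitrary: x)
  case (Cons i js)
  have "((\<lambda>x. 0) has_derivative (\<lambda>h. 0)) (at x)" by simp
  then have "(partial_derivs js f has_derivative (\<lambda>h. 0)) (at x)"
    by (rule has_derivative_transform_within_open[OF _ assms(1) Cons.prems]) (use Cons.IH in auto)
  then show ?case using partial_deriv_eq by fastforce
qed (use assms in auto)

text \<open>An explicit bound on every tensor entry replaces the norm in all estimates, so that no
  supremum has to be known finite beforehand.\<close>

definition derivs_bounded :: "nat \<Rightarrow> (real^'n::finite \<Rightarrow> real) \<Rightarrow> real \<Rightarrow> bool" where
  "derivs_bounded l f K \<longleftrightarrow> (\<forall>is. length is \<le> l \<longrightarrow> (\<forall>x. \<bar>partial_derivs is f x\<bar> \<le> K))"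

lemma derivs_bounded_0: "derivs_bounded 0 f K \<longleftrightarrow> (\<forall>x. \<bar>f x\<bar> \<le> K)"
  by (simp add: derivs_bounded_def)

lemma derivs_bounded_Suc:
  "derivs_bounded (Suc l) f K \<longleftrightarrow> (\<forall>x. \<bar>f x\<bar> \<le> K) \<and> (\<forall>i. derivs_bounded l (partial_deriv i f) K)"
  unfolding derivs_bounded_def all_lists_le_Suc by auto

lemma derivs_bounded_mono: "derivs_bounded l f K \<Longrightarrow> K \<le> K' \<Longrightarrow> k \<le> l \<Longrightarrow> derivs_bounded k f K'"
  unfolding derivs_bounded_def by (auto intro: order_trans)

lemma derivs_bounded_abs: "derivs_bounded l f K \<Longrightarrow> \<bar>f x\<bar> \<le> K"
  by (auto simp: derivs_bounded_def dest!: spec[of _ "[]"])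

lemma derivs_bounded_add:
  assumes "f \<in> C_space l" "g \<in> C_space l" "derivs_bounded l f A" "derivs_bounded l g B"
  shows "derivs_bounded l (\<lambda>x. f x + g x) (A + B)"
  using assms(3,4) unfolding derivs_bounded_def
  by (auto simp: partial_derivs_add[OF assms(1,2)] intro!: order_trans[OF abs_triangle_ineq] add_mono)

lemma derivs_bounded_cmult:
  assumes "f \<in> C_space l" "derivs_bounded l f A"
  shows "derivs_bounded l (\<lambda>x. c * f x) (\<bar>c\<bar> * A)"
  using assms(2) unfolding derivs_bounded_def
  by (auto simp: partial_derivs_cmult[OF assms(1)] abs_mult mult_left_mono)

text \<open>By the product rule each differentiation doubles the number of terms, hence the factor
  \<open>2 ^ l\<close>.\<close>

lemma derivs_bounded_mult:
  assumes "f \<in> C_space l" "g \<in> C_space l" "derivs_bounded l f A" "derivs_bounded l g B"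
  shows "derivs_bounded l (\<lambda>x. f x * g x) (2 ^ l * A * B)"
  using assms
proof (induction l arbitrary: f g)
  case 0
  then show ?case by (auto simp: derivs_bounded_0 abs_mult intro!: mult_mono order_trans[OF abs_ge_zero])
next
  case (Suc l)
  have A: "0 \<le> A" "0 \<le> B"
    using derivs_bounded_abs[OF Suc.prems(3)] derivs_bounded_abs[OF Suc.prems(4)] order_trans[OF abs_ge_zero] by auto
  have m: "f \<in> C_space l" "g \<in> C_space l" "derivs_bounded l f A" "derivs_bounded l g B"
    using Suc.prems C_space_SucD by (auto intro: derivs_bounded_mono[where l="Suc l"])
  have fg: "partial_deriv i f \<in> C_space l" "partial_deriv i g \<in> C_space l" 
    "derivs_bounded l (partial_deriv i f) A" "derivs_bounded l (partial_deriv i g) B" for i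
    using Suc.prems by (auto simp: C_space_Suc derivs_bounded_Suc)
  have eq: "partial_deriv i (\<lambda>x. f x * g x) =
      (\<lambda>x. f x * partial_deriv i g x + partial_deriv i f x * g x)" for i
    using Suc.prems by (auto simp: C_space_Suc partial_deriv_mult)
  have "derivs_bounded l (partial_deriv i (\<lambda>x. f x * g x)) (2 ^ l * A * B + 2 ^ l * A * B)" for i
    unfolding eq by (intro derivs_bounded_add Suc.IH C_space_mult m fg)
  moreover have "\<bar>f x * g x\<bar> \<le> 2 ^ Suc l * A * B" for x
  proof -
    have "\<bar>f x * g x\<bar> \<le> A * B"
      using derivs_bounded_abs[OF m(3), of x] derivs_bounded_abs[OF m(4), of x] A
      by (auto simp: abs_mult intro!: mult_mono)
    also have "\<dots> \<le> 2 ^ Suc l * (A * B)"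
      using mult_right_mono[OF one_le_power[of "2::real" "Suc l"], of "A * B"] A by simp
    finally show ?thesis by simp
  qed
  ultimately show ?case by (simp add: derivs_bounded_Suc algebra_simps)
qed

section \<open>Functions vanishing at infinity with their derivatives\<close>

lemma bounded_of_tendsto_zero:
  fixes h :: "real^'n::finite \<Rightarrow> real"
  assumes "continuous_on UNIV h" "(h \<longlongrightarrow> 0) at_infinity"
  shows "\<exists>K. \<forall>x. \<bar>h x\<bar> \<le> K"
proof -
  obtain b where b: "\<And>x. norm x \<ge> b \<Longrightarrow> \<bar>h x\<bar> < 1"
    using assms(2)[unfolded tendsto_iff, rule_format, of 1] by (auto simp: eventually_at_infinity)
  have "bounded (h ` cball 0 b)"
    using assms(1) by (intro compact_imp_bounded compact_continuous_image) (auto intro: continuous_on_subset)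
  then obtain B where B: "\<And>x. x \<in> cball 0 b \<Longrightarrow> \<bar>h x\<bar> \<le> B"
    unfolding bounded_iff by (metis image_eqI real_norm_def)
  have "\<bar>h x\<bar> \<le> max B 1" for x
    using B[of x] b[of x] by (cases "norm x \<le> b") (auto simp: le_max_iff_disj intro: less_imp_le)
  then show ?thesis by blast
qed

text \<open>There are finitely many index lists of length at most \<open>l\<close>, so the sum of
  the absolute values of their individual bounds is a common one; adding 1 makes it positive, since
  later arguments divide by it.\<close>

lemma C0_space_bounded:
  assumes "f \<in> C0_space l"
  obtains K where "0 < K" "derivs_bounded l f K"
proof -
  have "\<forall>is. \<exists>K. length is \<le> l \<longrightarrow> (\<forall>x. \<bar>partial_derivs is f x\<bar> \<le> K)"
    using assms by (auto simp: C0_space_def C_space_def intro!: bounded_of_tendsto_zero)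
  then obtain K where K: "\<And>is x. length is \<le> l \<Longrightarrow> \<bar>partial_derivs is f x\<bar> \<le> K is"
    by metis
  let ?L = "{is. length is \<le> l}"
  have "K is \<le> (\<Sum>is\<in>?L. \<bar>K is\<bar>) + 1" if "length is \<le> l" for "is"
    using member_le_sum[of "is" ?L "\<lambda>is. \<bar>K is\<bar>"] that by auto
  then have "derivs_bounded l f ((\<Sum>is\<in>?L. \<bar>K is\<bar>) + 1)"
    unfolding derivs_bounded_def using order_trans[OF K] by simp
  moreover have "0 < (\<Sum>is\<in>?L. \<bar>K is\<bar>) + 1" by (simp add: add_nonneg_pos sum_nonneg)
  ultimately show ?thesis using that by blast
qed

lemma C0_space_C_space: "f \<in> C0_space l \<Longrightarrow> f \<in> C_space l"
  by (simp add: C0_space_def)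

lemma C0_space_tendsto: "f \<in> C0_space l \<Longrightarrow> (f \<longlongrightarrow> 0) at_infinity"
  by (auto simp: C0_space_def dest!: spec[of _ "[]"])

lemma C0_space_Suc:
  assumes "f \<in> C0_space (Suc l)"
  shows "f \<in> C0_space l" "partial_deriv i f \<in> C0_space l"
proof -
  have f: "f \<in> C_space (Suc l)" "\<And>is. length is \<le> Suc l \<Longrightarrow> (partial_derivs is f \<longlongrightarrow> 0) at_infinity"
    using assms by (auto simp: C0_space_def)
  show "f \<in> C0_space l" using f C_space_SucD by (simp add: C0_space_def)
  have "(partial_derivs is (partial_deriv i f) \<longlongrightarrow> 0) at_infinity" if "length is \<le> l" for "is"
    using f(2)[of "is @ [i]"] that by simp
  then show "partial_deriv i f \<in> C0_space l" using f(1) by (simp add: C0_space_def C_space_Suc)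
qed

lemma Cc_space_subset_C0_space: "Cc_space l \<subseteq> C0_space l"
proof
  fix f :: "real^'n::finite \<Rightarrow> real" assume f: "f \<in> Cc_space l"
  let ?S = "closure {x. f x \<noteq> 0}"
  have "bounded ?S" using f by (auto simp: Cc_space_def dest: compact_imp_bounded)
  then obtain b where b: "\<And>x. x \<in> ?S \<Longrightarrow> norm x \<le> b" unfolding bounded_iff by blast
  have z: "partial_derivs is f x = 0" if "norm x \<ge> b + 1" for "is" x
  proof (rule partial_derivs_zero_on_open)
    show "f y = 0" if "y \<in> - ?S" for y
      using that closure_subset[of "{x. f x \<noteq> 0}"] by auto
    show "x \<in> - ?S" using b[of x] that by auto
  qed auto
  then have "(partial_derivs is f \<longlongrightarrow> 0) at_infinity" for "is"
    by (intro tendsto_eventually) (auto simp: eventually_at_infinity)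
  then show "f \<in> C0_space l" using f by (simp add: C0_space_def Cc_space_def)
qed

section \<open>The norm\<close>

text \<open>Gives access to the Minkowski inequality for \<open>L2_set\<close>, from which the
  triangle inequality of the norm follows.\<close>

lemma deriv_tensor_norm_L2_set:
  "deriv_tensor_norm j f x = L2_set (\<lambda>is. partial_derivs is f x) {is. length is = j}"
  by (simp add: deriv_tensor_norm_def L2_set_def)

text \<open>The constant comparing an entrywise bound with \<open>C_norm\<close>. The dimension is a
  type, so it is passed as a type argument.\<close>

definition num_derivs :: "'n::finite itself \<Rightarrow> nat \<Rightarrow> real" where
  "num_derivs _ l = card {is :: 'n list. length is \<le> l}"

lemma num_derivs_pos: "num_derivs TYPE('n::finite) l > 0"
  by (auto simp: num_derivs_def card_gt_0_iff intro!: exI[of _ "[]"])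

lemma deriv_tensor_norm_le:
  fixes f :: "real^'n::finite \<Rightarrow> real"
  assumes "derivs_bounded l f K" "j \<le> l"
  shows "deriv_tensor_norm j f x \<le> num_derivs TYPE('n) l * K"
proof -
  have K: "0 \<le> K" using order_trans[OF abs_ge_zero derivs_bounded_abs[OF assms(1)]] .
  have "deriv_tensor_norm j f x \<le> (\<Sum>is | length is = j. \<bar>partial_derivs is f x\<bar>)"
    unfolding deriv_tensor_norm_L2_set by (rule L2_set_le_sum_abs)
  also have "\<dots> \<le> (\<Sum>is :: 'n list | length is = j. K)"
    using assms by (intro sum_mono) (auto simp: derivs_bounded_def)
  also have "\<dots> = real (card {is :: 'n list. length is = j}) * K" by simp
  also have "\<dots> \<le> num_derivs TYPE('n) l * K"
    unfolding num_derivs_def using K assms(2)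
    by (intro mult_right_mono) (auto intro!: card_mono)
  finally show ?thesis .
qed

lemma abs_partial_derivs_le: "\<bar>partial_derivs is f x\<bar> \<le> deriv_tensor_norm (length is) f x"
  unfolding deriv_tensor_norm_L2_set
  using member_le_L2_set[of "{js. length js = length is}" "is" "\<lambda>is. \<bar>partial_derivs is f x\<bar>"]
  by (simp add: L2_set_def)

text \<open>The bound \<open>K\<close> makes the real suprema genuine ones; its size does not enter
  the conclusion.\<close>

lemma C_norm_le_iff:
  fixes f :: "real^'n::finite \<Rightarrow> real"
  assumes "derivs_bounded l f K"
  shows "C_norm l f \<le> a \<longleftrightarrow> (\<forall>j\<le>l. \<forall>x. deriv_tensor_norm j f x \<le> a)"
proof -
  have "(SUP x. deriv_tensor_norm j f x) \<le> a \<longleftrightarrow> (\<forall>x. deriv_tensor_norm j f x \<le> a)" if "j \<le> l" for j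
    using deriv_tensor_norm_le[OF assms that]
    by (subst cSUP_le_iff) (auto intro!: bdd_aboveI2)
  then show ?thesis by (auto simp: C_norm_def)
qed

lemma C_norm_le:
  fixes f :: "real^'n::finite \<Rightarrow> real"
  assumes "derivs_bounded l f K"
  shows "C_norm l f \<le> num_derivs TYPE('n) l * K"
  by (simp add: C_norm_le_iff[OF assms] deriv_tensor_norm_le[OF assms])

lemma deriv_tensor_norm_le_C_norm:
  assumes "derivs_bounded l f K" "j \<le> l"
  shows "deriv_tensor_norm j f x \<le> C_norm l f"
  using iffD1[OF C_norm_le_iff[OF assms(1)] order_refl] assms(2) by simp

text \<open>Any bound, however poor, certifies that the suprema are finite, and then the norm itself
  dominates every entry, since an entry is at most the Euclidean norm of its tensor.\<close>

lemma derivs_bounded_C_norm: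
  assumes "derivs_bounded l f K"
  shows "derivs_bounded l f (C_norm l f)"
  unfolding derivs_bounded_def
  using order_trans[OF abs_partial_derivs_le deriv_tensor_norm_le_C_norm[OF assms]] by simp

lemma C_norm_add_le:
  assumes "f \<in> C_space l" "g \<in> C_space l" "derivs_bounded l f A" "derivs_bounded l g B"
  shows "C_norm l (\<lambda>x. f x + g x) \<le> C_norm l f + C_norm l g"
proof -
  have "deriv_tensor_norm j (\<lambda>x. f x + g x) x \<le> C_norm l f + C_norm l g" if "j \<le> l" for j x
  proof -
    have "deriv_tensor_norm j (\<lambda>x. f x + g x) x =
        L2_set (\<lambda>is. partial_derivs is f x + partial_derivs is g x) {is. length is = j}"
      unfolding deriv_tensor_norm_L2_set
      using that by (intro L2_set_cong) (auto simp: partial_derivs_add[OF assms(1,2)])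
    also have "\<dots> \<le> deriv_tensor_norm j f x + deriv_tensor_norm j g x"
      unfolding deriv_tensor_norm_L2_set by (rule L2_set_triangle_ineq)
    also have "\<dots> \<le> C_norm l f + C_norm l g"
      by (intro add_mono deriv_tensor_norm_le_C_norm[OF assms(3) that] deriv_tensor_norm_le_C_norm[OF assms(4) that])
    finally show ?thesis .
  qed
  then show ?thesis by (simp add: C_norm_le_iff[OF derivs_bounded_add[OF assms]])
qed

lemma C_norm_cmult_le:
  assumes "f \<in> C_space l" "derivs_bounded l f A"
  shows "C_norm l (\<lambda>x. c * f x) \<le> \<bar>c\<bar> * C_norm l f"
proof -
  have "deriv_tensor_norm j (\<lambda>x. c * f x) x \<le> \<bar>c\<bar> * C_norm l f" if "j \<le> l" for j x
  proof -
    have "deriv_tensor_norm j (\<lambda>x. c * f x) x = sqrt (c\<^sup>2 * (\<Sum>is | length is = j. (partial_derivs is f x)\<^sup>2))"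
      unfolding deriv_tensor_norm_def sum_distrib_left
      using that by (intro arg_cong[of _ _ sqrt] sum.cong)
        (auto simp: partial_derivs_cmult[OF assms(1)] power_mult_distrib)
    also have "\<dots> = \<bar>c\<bar> * deriv_tensor_norm j f x"
      by (simp add: real_sqrt_mult deriv_tensor_norm_def)
    also have "\<dots> \<le> \<bar>c\<bar> * C_norm l f"
      by (intro mult_left_mono deriv_tensor_norm_le_C_norm[OF assms(2) that]) simp
    finally show ?thesis .
  qed
  then show ?thesis by (simp add: C_norm_le_iff[OF derivs_bounded_cmult[OF assms]])
qed

section \<open>Cutoff functions\<close>

text \<open>The squared norm keeps the inner function polynomial, and \<open>Suc l\<close> is the
  smallest exponent for which the positive part is shown to be of class \<open>l\<close>. Unlike the
  usual bump it is not constant near 0; continuity at 0, where it equals 1, takes the place of a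
  plateau.\<close>

definition cutoff :: "nat \<Rightarrow> real^'n::finite \<Rightarrow> real" where
  "cutoff l x = (max 0 (1 - x \<bullet> x)) ^ Suc l"

lemma cutoff_C_space: "cutoff l \<in> C_space l"
proof -
  have "real_polynomial_function (\<lambda>x::real^'n. 1 + (- 1) * (\<Sum>i\<in>UNIV. (x $ i) * (x $ i)))"
    by (intro real_polynomial_function.intros real_polynomial_function_sum bounded_linear_vec_nth) auto
  then have "(\<lambda>x::real^'n. 1 - x \<bullet> x) \<in> C_space l"
    by (intro C_space_real_polynomial) (simp add: inner_vec_def)
  then have "(\<lambda>x::real^'n. (max 0 (1 - x \<bullet> x)) ^ Suc l) \<in> C_space l"
    by (rule C_space_pos_part_power) simp
  then show ?thesis by (simp add: cutoff_def[abs_def])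
qed

lemma cutoff_nonneg [simp]: "0 \<le> cutoff l x"
  by (simp add: cutoff_def)

lemma cutoff_le_1 [simp]: "cutoff l x \<le> 1"
  unfolding cutoff_def by (intro power_le_one) auto

lemma cutoff_0 [simp]: "cutoff l 0 = 1"
  by (simp add: cutoff_def)

lemma cutoff_eq_0: "norm x \<ge> 1 \<Longrightarrow> cutoff l x = 0"
  using one_le_power[of "norm x" 2] by (simp add: cutoff_def dot_square_norm max_absorb1)

lemma isCont_cutoff: "isCont (cutoff l) (x :: real^'n::finite)"
proof -
  have "continuous_on UNIV (cutoff l :: real^'n \<Rightarrow> real)"
    by (rule C_space_continuous[OF cutoff_C_space])
  then show ?thesis by (simp add: continuous_on_eq_continuous_at)
qed

lemma cutoff_Cc_space: "(cutoff l :: real^'n::finite \<Rightarrow> real) \<in> Cc_space l"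
proof -
  have "closure {x::real^'n. cutoff l x \<noteq> 0} \<subseteq> cball 0 1"
    by (intro closure_minimal) (auto simp: cutoff_eq_0 intro: ccontr)
  then have "compact (closure {x::real^'n. cutoff l x \<noteq> 0})"
    using compact_eq_bounded_closed bounded_subset[OF bounded_cball] closed_closure by blast
  then show ?thesis by (simp add: Cc_space_def cutoff_C_space)
qed

lemma cutoff_derivs_bounded:
  obtains K where "0 < K" "derivs_bounded l (cutoff l :: real^'n::finite \<Rightarrow> real) K"
  using C0_space_bounded[OF subsetD[OF Cc_space_subset_C0_space cutoff_Cc_space]] .

lemma cutoff_scale_mult_Cc_space:
  assumes "f \<in> C_space l" "c > 0"
  shows "(\<lambda>x. cutoff l (c *\<^sub>R x) * f x) \<in> Cc_space l"
proof -
  have "cutoff l (c *\<^sub>R x) * f x = 0" if "norm x > 1 / c" for x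
    using that assms(2) cutoff_eq_0[of "c *\<^sub>R x" l] by (simp add: field_simps)
  then have "{x. cutoff l (c *\<^sub>R x) * f x \<noteq> 0} \<subseteq> cball 0 (1 / c)"
    by (force simp: not_less[symmetric])
  then have "compact (closure {x. cutoff l (c *\<^sub>R x) * f x \<noteq> 0})"
    by (meson bounded_cball bounded_subset compact_closure)
  then show ?thesis
    using C_space_mult[OF C_space_scale[OF cutoff_C_space] assms(1)] by (simp add: Cc_space_def)
qed

lemma cutoff_scale_bounded:
  fixes K :: real
  assumes "derivs_bounded l (cutoff l :: real^'n::finite \<Rightarrow> real) K" "0 \<le> c" "c \<le> 1"
  shows "derivs_bounded l (\<lambda>x::real^'n. cutoff l (c *\<^sub>R x)) K"
  unfolding derivs_bounded_def
proof (intro allI impI)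
  fix "is" :: "'n list" and x :: "real^'n"
  assume "length is \<le> l"
  then have "\<bar>partial_derivs is (\<lambda>x::real^'n. cutoff l (c *\<^sub>R x)) x\<bar> = c ^ length is * \<bar>partial_derivs is (cutoff l) (c *\<^sub>R x)\<bar>"
    using assms(2) by (simp add: partial_derivs_scale[OF cutoff_C_space] abs_mult)
  also have "\<dots> \<le> 1 * \<bar>partial_derivs is (cutoff l) (c *\<^sub>R x)\<bar>"
    using assms(2,3) by (intro mult_right_mono power_le_one) auto
  also have "\<dots> \<le> K" using assms(1) \<open>length is \<le> l\<close> by (simp add: derivs_bounded_def)
  finally show "\<bar>partial_derivs is (\<lambda>x. cutoff l (c *\<^sub>R x)) x\<bar> \<le> K" .
qed

lemma cutoff_tendsto_1:
  "((\<lambda>c. cutoff l (c *\<^sub>R x)) \<longlongrightarrow> 1) (at_right 0)"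
proof -
  have "((\<lambda>c::real. c *\<^sub>R x) \<longlongrightarrow> 0 *\<^sub>R x) (at_right 0)" by (intro tendsto_intros)
  then show ?thesis using isCont_tendsto_compose[OF isCont_cutoff, of _ 0] by fastforce
qed

text \<open>Where the cutoff is not close to 1 the function itself is small; every derivative that falls
  on the cutoff brings out a factor \<open>c\<close>.\<close>

lemma cutoff_approximation:
  fixes f \<phi> :: "real^'n::finite \<Rightarrow> real"
  assumes "\<phi> \<in> C_space l" "\<phi> 0 = 1" "derivs_bounded l \<phi> K" "f \<in> C0_space l" "0 < e"
  shows "\<forall>\<^sub>F c in at_right 0. derivs_bounded l (\<lambda>x. (\<phi> (c *\<^sub>R x) - 1) * f x) e"
  using assms
\<comment> \<open>The function \<open>\<phi>\<close> is abstract and fixed: \<open>cutoff l\<close>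
  itself changes with \<open>l\<close>, so the induction could not be run on it directly.\<close>
proof (induction l arbitrary: f e)
  case main: 0
  have "0 \<le> K" using derivs_bounded_abs[OF main(3)] order_trans[OF abs_ge_zero] by blast
  have phi: "\<bar>\<phi> y - 1\<bar> \<le> K + 1" for y
    using derivs_bounded_abs[OF main(3), of y] by linarith
  obtain B where B: "0 < B" "derivs_bounded 0 f B" using C0_space_bounded[OF main(4)] .
  obtain b where b: "\<And>x. norm x \<ge> b \<Longrightarrow> \<bar>f x\<bar> < e / (K + 1)"
    using C0_space_tendsto[OF main(4), unfolded tendsto_iff, rule_format, of "e / (K + 1)"] main(5) \<open>0 \<le> K\<close>
    by (auto simp: eventually_at_infinity)
  have "isCont \<phi> 0" using main(1) by (simp add: C_space_0 continuous_on_eq_continuous_at)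
  then obtain d where d: "0 < d" "\<And>y. norm y < d \<Longrightarrow> \<bar>\<phi> y - 1\<bar> < e / B"
    using main(2,5) B(1) unfolding continuous_at_eps_delta
    by (metis dist_norm diff_zero divide_pos_pos real_norm_def)
  \<comment> \<open>For \<open>c < c0\<close> the whole ball of radius \<open>\<bar>b\<bar>\<close>
    is contracted into the \<open>d\<close>-ball about 0, where \<open>\<phi>\<close> is close to 1;
    outside the radius \<open>b\<close> the smallness of \<open>f\<close> suffices.\<close>
  define c0 where "c0 = d / (\<bar>b\<bar> + 1)"
  have c0: "0 < c0" using d(1) by (simp add: c0_def)
  have "derivs_bounded 0 (\<lambda>x. (\<phi> (c *\<^sub>R x) - 1) * f x) e" if c: "0 < c" "c < c0" for c
    unfolding derivs_bounded_0
  proof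
    fix x
    show "\<bar>(\<phi> (c *\<^sub>R x) - 1) * f x\<bar> \<le> e"
    proof (cases "norm x \<ge> b")
      case True
      have "\<bar>(\<phi> (c *\<^sub>R x) - 1) * f x\<bar> \<le> (K + 1) * (e / (K + 1))"
        unfolding abs_mult using phi b[OF True] \<open>0 \<le> K\<close> by (intro mult_mono) auto
      then show ?thesis using \<open>0 \<le> K\<close> by simp
    next
      case False
      have "norm (c *\<^sub>R x) \<le> c * (\<bar>b\<bar> + 1)" using False c by simp
      also have "\<dots> < d" using c by (simp add: c0_def field_simps)
      finally have "\<bar>\<phi> (c *\<^sub>R x) - 1\<bar> < e / B" by (rule d(2))
      then have "\<bar>(\<phi> (c *\<^sub>R x) - 1) * f x\<bar> \<le> e / B * B"
        unfolding abs_mult using derivs_bounded_abs[OF B(2)] B(1) main(5) by (intro mult_mono) auto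
      then show ?thesis using B by simp
    qed
  qed
  then show ?case using c0 unfolding eventually_at_right_field by blast
next
  case (Suc l)
  have phi: "\<phi> \<in> C_space l" "derivs_bounded l \<phi> K" "\<forall>x. \<phi> differentiable (at x)"
     "partial_deriv i \<phi> \<in> C_space l" "derivs_bounded l (partial_deriv i \<phi>) K" for i
    using Suc.prems C_space_SucD[OF Suc.prems(1)]
    by (auto simp: C_space_Suc derivs_bounded_Suc intro: derivs_bounded_mono[where l = "Suc l"])
  have f: "f \<in> C0_space l" "partial_deriv i f \<in> C0_space l" "\<forall>x. f differentiable (at x)" for i
    using C0_space_Suc[OF Suc.prems(4)] C0_space_C_space[OF Suc.prems(4)] by (auto simp: C_space_Suc)
  have "0 \<le> K" using derivs_bounded_abs[OF phi(2)] order_trans[OF abs_ge_zero] by blast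
  obtain B where B: "0 < B" "derivs_bounded l f B" using C0_space_bounded[OF f(1)] .
  have e2: "0 < e / 2" using Suc.prems by simp
  have one: "(\<lambda>x. \<phi> (c *\<^sub>R x) - 1) \<in> C_space l" for c
    using C_space_add[OF C_space_scale[OF phi(1)] C_space_const[of "-1"]] by simp
  have d1: "(\<lambda>x. \<phi> (c *\<^sub>R x) - 1) differentiable (at x)" for c x
    using partial_deriv_scale(2) phi(3) by (intro derivative_intros) auto
  have pd: "partial_deriv i (\<lambda>x. (\<phi> (c *\<^sub>R x) - 1) * f x) =
      (\<lambda>x. (\<phi> (c *\<^sub>R x) - 1) * partial_deriv i f x + (c * partial_deriv i \<phi> (c *\<^sub>R x)) * f x)" for i c
  proof
    fix x
    have "partial_deriv i (\<lambda>x. \<phi> (c *\<^sub>R x) + (- 1)) x = c * partial_deriv i \<phi> (c *\<^sub>R x)"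
      using partial_deriv_scale(1)[of \<phi> c x i] partial_deriv_scale(2)[of \<phi> c x] phi(3)
      by (subst partial_deriv_add) (auto simp: partial_deriv_const)
    then show "partial_deriv i (\<lambda>x. (\<phi> (c *\<^sub>R x) - 1) * f x) x =
      (\<phi> (c *\<^sub>R x) - 1) * partial_deriv i f x + (c * partial_deriv i \<phi> (c *\<^sub>R x)) * f x"
      using partial_deriv_mult[OF d1, of f x i c] f(3) by simp
  qed
  have "\<forall>\<^sub>F c in at_right 0. derivs_bounded l (\<lambda>x. (\<phi> (c *\<^sub>R x) - 1) * f x) e"
    using Suc.IH[OF phi(1) Suc.prems(2) phi(2) f(1)] Suc.prems(5) .
  moreover have "\<forall>\<^sub>F c in at_right 0. \<forall>i. derivs_bounded l (\<lambda>x. (\<phi> (c *\<^sub>R x) - 1) * partial_deriv i f x) (e / 2)"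
    using Suc.IH[OF phi(1) Suc.prems(2) phi(2) f(2) e2] by (simp add: eventually_all_finite)
  \<comment> \<open>The threshold makes \<open>2 ^ l * (c * K) * B\<close>, the product bound for
    the term whose derivative falls on \<open>\<phi>\<close>, at most \<open>e / 2\<close>; the
    added 1 keeps the denominator positive.\<close>
  moreover have "\<forall>\<^sub>F c in at_right 0. 0 < c \<and> c < min 1 (e / 2 / (2 ^ l * K * B + 1))"
    using e2 \<open>0 \<le> K\<close> B(1) by (intro eventually_conj eventually_at_right_less eventually_at_rightI[where b = "min 1 (e / 2 / (2 ^ l * K * B + 1))"])
      (auto intro!: divide_pos_pos add_nonneg_pos)
  ultimately show ?case
  proof eventually_elim
    case (elim c)
    have "derivs_bounded l (\<lambda>x. (\<phi> (c *\<^sub>R x) - 1) * partial_deriv i f x + (c * partial_deriv i \<phi> (c *\<^sub>R x)) * f x) e" for i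
    proof -
      have K: "derivs_bounded l (\<lambda>x. partial_deriv i \<phi> (c *\<^sub>R x)) K"
        unfolding derivs_bounded_def
      proof (intro allI impI)
        fix "is" :: "'n list" and x
        assume l: "length is \<le> l"
        have "\<bar>partial_derivs is (\<lambda>x. partial_deriv i \<phi> (c *\<^sub>R x)) x\<bar> = c ^ length is * \<bar>partial_derivs is (partial_deriv i \<phi>) (c *\<^sub>R x)\<bar>"
          using elim by (simp add: partial_derivs_scale[OF phi(4) l] abs_mult)
        also have "\<dots> \<le> 1 * \<bar>partial_derivs is (partial_deriv i \<phi>) (c *\<^sub>R x)\<bar>"
          using elim by (intro mult_right_mono power_le_one) auto
        also have "\<dots> \<le> K" using phi(5) l by (simp add: derivs_bounded_def)
        finally show "\<bar>partial_derivs is (\<lambda>x. partial_deriv i \<phi> (c *\<^sub>R x)) x\<bar> \<le> K" .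
      qed
      have "derivs_bounded l (\<lambda>x. (c * partial_deriv i \<phi> (c *\<^sub>R x)) * f x) (2 ^ l * (\<bar>c\<bar> * K) * B)"
        by (intro derivs_bounded_mult derivs_bounded_cmult K B(2) C_space_mult C_space_const
            C_space_scale phi(4) C0_space_C_space[OF f(1)])
      moreover have "2 ^ l * (\<bar>c\<bar> * K) * B \<le> e / 2"
      proof -
        have "2 ^ l * (\<bar>c\<bar> * K) * B = c * (2 ^ l * K * B)" using elim by simp
        also have "\<dots> \<le> c * (2 ^ l * K * B + 1)" using elim by (intro mult_left_mono) auto
        also have "\<dots> \<le> e / 2"
          using elim(3) B(1) \<open>0 \<le> K\<close> pos_less_divide_eq[of "2 ^ l * K * B + 1" c "e / 2"]
          by (simp only: min_less_iff_conj) (simp add: add_nonneg_pos)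
        finally show ?thesis .
      qed
      ultimately have "derivs_bounded l (\<lambda>x. (c * partial_deriv i \<phi> (c *\<^sub>R x)) * f x) (e / 2)"
        using derivs_bounded_mono by blast
      then have "derivs_bounded l (\<lambda>x. (\<phi> (c *\<^sub>R x) - 1) * partial_deriv i f x + (c * partial_deriv i \<phi> (c *\<^sub>R x)) * f x) (e / 2 + e / 2)"
        using elim(2) by (intro derivs_bounded_add C_space_mult C_space_const C_space_scale one phi(4)
            C0_space_C_space[OF f(1)] C0_space_C_space[OF f(2)]) auto
      then show ?thesis by simp
    qed
    then show ?case
      unfolding derivs_bounded_Suc pd by (intro conjI allI derivs_bounded_abs[OF elim(1)])
  qed
qed

section \<open>Density of compactly supported functions in the unit ball\<close>

lemma Cc_dense_in_C0:
  fixes f :: "real^'n::finite \<Rightarrow> real"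
  assumes "f \<in> C0_space l" "0 < e"
  obtains g where "g \<in> Cc_space l" "derivs_bounded l (\<lambda>x. g x - f x) e"
proof -
  obtain K where "derivs_bounded l (cutoff l :: real^'n \<Rightarrow> real) K"
    using cutoff_derivs_bounded .
  from cutoff_approximation[OF cutoff_C_space cutoff_0 this assms]
  have "\<forall>\<^sub>F c in at_right 0. derivs_bounded l (\<lambda>x. (cutoff l (c *\<^sub>R x) - 1) * f x) e \<and> 0 < c"
    using eventually_at_right_less by (rule eventually_conj)
  then obtain c :: real where c: "derivs_bounded l (\<lambda>x. (cutoff l (c *\<^sub>R x) - 1) * f x) e" "0 < c"
    using eventually_happens'[OF trivial_limit_at_right_real] by blast
  show ?thesis
  proof (rule that)
    show "(\<lambda>x. cutoff l (c *\<^sub>R x) * f x) \<in> Cc_space l"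
      by (rule cutoff_scale_mult_Cc_space[OF C0_space_C_space[OF assms(1)] c(2)])
    show "derivs_bounded l (\<lambda>x. cutoff l (c *\<^sub>R x) * f x - f x) e"
      using c(1) by (simp add: algebra_simps)
  qed
qed

lemma Cc_space_cmult: "f \<in> Cc_space l \<Longrightarrow> (\<lambda>x. c * f x) \<in> Cc_space l"
  by (cases "c = 0") (auto simp: Cc_space_def C_space_const C_space_mult)

text \<open>An approximant \<open>g\<close> with entrywise error \<open>a\<close> may leave the unit
  ball, but its norm is at most \<open>1 + N * a\<close>. Multiplying by the inverse
  \<open>s\<close> of that number repairs this at a cost of \<open>N * a\<close>, and
  \<open>a = e / (1 + N)\<close> makes the total error \<open>e\<close>.\<close>

lemma C_norm_dense_ball:
  fixes f :: "real^'n::finite \<Rightarrow> real"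
  assumes f: "f \<in> C0_unit_ball l" and "0 < e"
  obtains g where "g \<in> Cc_space l" "C_norm l g \<le> 1" "derivs_bounded l (\<lambda>x. g x - f x) e"
proof -
  define N where "N = num_derivs TYPE('n) l"
  have N: "0 < N" unfolding N_def by (rule num_derivs_pos)
  define a where "a = e / (1 + N)"
  have a: "0 < a" using N assms(2) by (simp add: a_def)
  have f0: "f \<in> C0_space l" "C_norm l f \<le> 1" using f by (auto simp: C0_unit_ball_def)
  obtain A where A: "derivs_bounded l f A" using C0_space_bounded[OF f0(1)] .
  obtain g where g: "g \<in> Cc_space l" "derivs_bounded l (\<lambda>x. g x - f x) a"
    using Cc_dense_in_C0[OF f0(1) a] .
  have g0: "g \<in> C_space l" using g(1) by (simp add: Cc_space_def)
  have gf: "(\<lambda>x. g x - f x) \<in> C_space l"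
    using C_space_add[OF g0 C_space_mult[OF C_space_const[of "-1"] C0_space_C_space[OF f0(1)]]] by simp
  obtain G where G: "derivs_bounded l g G"
    using C0_space_bounded[OF subsetD[OF Cc_space_subset_C0_space g(1)]] .
  have "C_norm l (\<lambda>x. f x + (g x - f x)) \<le> C_norm l f + C_norm l (\<lambda>x. g x - f x)"
    by (rule C_norm_add_le[OF C0_space_C_space[OF f0(1)] gf A g(2)])
  also have "\<dots> \<le> 1 + N * a" using f0(2) C_norm_le[OF g(2)] by (simp add: N_def)
  finally have gn: "C_norm l g \<le> 1 + N * a" by simp
  define s where "s = 1 / (1 + N * a)"
  have "0 < N * a" using N a by simp
  then have s: "0 < s" "s \<le> 1" "s * (1 + N * a) = 1"
    by (auto simp: s_def)
  show ?thesis
  proof (rule that)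
    show "(\<lambda>x. s * g x) \<in> Cc_space l" by (rule Cc_space_cmult[OF g(1)])
    have "C_norm l (\<lambda>x. s * g x) \<le> \<bar>s\<bar> * C_norm l g" by (rule C_norm_cmult_le[OF g0 G])
    also have "\<dots> \<le> s * (1 + N * a)" using mult_left_mono[OF gn, of s] s(1) by simp
    finally show "C_norm l (\<lambda>x. s * g x) \<le> 1" using s by simp
    \<comment> \<open>The error \<open>s * g - f\<close> is split into the loss by shrinking and the
      original error.\<close>
    have "derivs_bounded l (\<lambda>x. (s - 1) * g x + (g x - f x)) (\<bar>s - 1\<bar> * (1 + N * a) + a)"
      using derivs_bounded_mono[OF derivs_bounded_C_norm[OF G] gn]
      by (intro derivs_bounded_add derivs_bounded_cmult C_space_mult C_space_const g0 gf g(2)) auto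
    moreover have "\<bar>s - 1\<bar> * (1 + N * a) + a = e"
    proof -
      have "\<bar>s - 1\<bar> * (1 + N * a) = (1 - s) * (1 + N * a)" using s(2) by simp
      also have "\<dots> = N * a" using s(3) by (simp add: algebra_simps)
      finally have "\<bar>s - 1\<bar> * (1 + N * a) + a = (1 + N) * a" by (simp add: algebra_simps)
      also have "\<dots> = e" using N by (simp add: a_def)
      finally show ?thesis .
    qed
    ultimately show "derivs_bounded l (\<lambda>x. s * g x - f x) e" by (simp add: algebra_simps)
  qed
qed

section \<open>Separability\<close>

text \<open>The first ball of the list containing \<open>x\<close> decides, so overlapping balls
  need no disjoint refinement. With centres in a countable dense set, rational values and radii
  \<open>1 / (k + 1)\<close> only countably many such functions arise; the default 0 suits functions
  that are small near infinity.\<close>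

definition step_fun :: "real \<Rightarrow> ('a::metric_space \<times> real) list \<Rightarrow> 'a \<Rightarrow> real" where
  "step_fun d L x = (case find (\<lambda>(c, v). dist c x < d) L of None \<Rightarrow> 0 | Some (c, v) \<Rightarrow> v)"

lemma step_fun_approximation:
  fixes h :: "'a::euclidean_space \<Rightarrow> real"
  assumes "continuous_on UNIV h" "(h \<longlongrightarrow> 0) at_infinity" "0 < e"
    and D: "\<And>X. open X \<Longrightarrow> X \<noteq> {} \<Longrightarrow> \<exists>d\<in>D. d \<in> X"
  shows "\<exists>k. \<exists>L\<in>lists (D \<times> \<rat>). \<forall>x. \<bar>h x - step_fun (inverse (Suc k)) L x\<bar> < e"
proof -
  obtain b where b: "\<And>x. norm x \<ge> b \<Longrightarrow> \<bar>h x\<bar> < e"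
    using assms(2)[unfolded tendsto_iff, rule_format, OF assms(3)] by (auto simp: eventually_at_infinity)
  \<comment> \<open>The radius \<open>b + 2\<close> leaves room: the centres lie within
    \<open>b + 1\<close> and the balls have radius at most 1, so uniform continuity also covers
    points of these balls outside \<open>cball 0 b\<close>.\<close>
  have "uniformly_continuous_on (cball 0 (b + 2)) h"
    using assms(1) by (intro compact_uniformly_continuous) (auto intro: continuous_on_subset)
  then obtain d where d: "0 < d"
    "\<And>x y. norm x \<le> b + 2 \<Longrightarrow> norm y \<le> b + 2 \<Longrightarrow> dist y x < d \<Longrightarrow> \<bar>h y - h x\<bar> < e / 2"
    using assms(3) unfolding uniformly_continuous_on_def by (metis half_gt_zero dist_real_def mem_cball_0)
  obtain k where k: "inverse (real (Suc k)) < d" using reals_Archimedean[OF d(1)] by blast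
  define \<delta> where "\<delta> = inverse (real (Suc k))"
  have \<delta>: "0 < \<delta>" "\<delta> \<le> 1" "\<delta> < d" using k by (auto simp: \<delta>_def inverse_le_1_iff)
  have "cball 0 b \<subseteq> (\<Union>c \<in> D \<inter> cball 0 (b + 1). ball c \<delta>)"
  proof
    fix x :: 'a assume x: "x \<in> cball 0 b"
    obtain c where c: "c \<in> D" "c \<in> ball x \<delta>" using D[of "ball x \<delta>"] \<delta> by auto
    have "norm c \<le> norm x + dist x c" using norm_triangle_sub[of c x] by (simp add: dist_norm norm_minus_commute)
    then show "x \<in> (\<Union>c \<in> D \<inter> cball 0 (b + 1). ball c \<delta>)" using x c \<delta> by (auto simp: dist_commute)
  qed
  then obtain C where C: "C \<subseteq> D \<inter> cball 0 (b + 1)" "finite C" "cball 0 b \<subseteq> (\<Union>c\<in>C. ball c \<delta>)"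
    using compactE_image[OF compact_cball, of "D \<inter> cball 0 (b + 1)" "\<lambda>c. ball c \<delta>" 0 b] by auto
  obtain cs where cs: "set cs = C" using finite_list[OF C(2)] by blast
  have "\<exists>v\<in>\<rat>. \<bar>h c - v\<bar> < e / 2" for c
    using Rats_dense_in_real[of "h c - e / 2" "h c + e / 2"] assms(3)
    by (auto simp: abs_less_iff intro!: bexI[of _ "_::real"])
      (smt (verit) field_sum_of_halves)
  then obtain v where v: "\<And>c. v c \<in> \<rat>" "\<And>c. \<bar>h c - v c\<bar> < e / 2" by metis
  define L where "L = map (\<lambda>c. (c, v c)) cs"
  have "L \<in> lists (D \<times> \<rat>)" using cs C(1) v(1) by (auto simp: L_def)
  moreover have "\<bar>h x - step_fun (inverse (Suc k)) L x\<bar> < e" for x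
  proof (cases "find (\<lambda>(c, v). dist c x < \<delta>) L")
    case None
    then have "\<not> norm x \<le> b"
      using C(3) cs by (auto simp: find_None_iff L_def)
    then show ?thesis using b[of x] None by (simp add: step_fun_def \<delta>_def)
  next
    case (Some p)
    then obtain c where c: "p = (c, v c)" "c \<in> C" "dist c x < \<delta>"
      using cs by (auto simp: find_Some_iff L_def)
    have "norm x \<le> norm c + dist c x" using norm_triangle_sub[of x c] by (simp add: dist_norm norm_minus_commute)
    then have "\<bar>h c - h x\<bar> < e / 2"
      using c C(1) \<delta> by (intro d(2)) auto
    then have "\<bar>h x - v c\<bar> < e" using v(2)[of c] by linarith
    then show ?thesis using Some c by (simp add: step_fun_def \<delta>_def)
  qed
  ultimately show ?thesis by blast
qed

lemma countable_uniformly_dense_C0: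
  obtains Q :: "('a::euclidean_space \<Rightarrow> real) set" where "countable Q"
    "\<forall>h. continuous_on UNIV h \<longrightarrow> (h \<longlongrightarrow> 0) at_infinity \<longrightarrow> (\<forall>e>0. \<exists>q\<in>Q. \<forall>x. \<bar>h x - q x\<bar> < e)"
proof -
  obtain D :: "'a set" where D: "countable D" "\<And>X. open X \<Longrightarrow> X \<noteq> {} \<Longrightarrow> \<exists>d\<in>D. d \<in> X"
    using countable_dense_exists by metis
  define Q where "Q = (\<lambda>(k, L). step_fun (inverse (Suc k)) L) ` ((UNIV :: nat set) \<times> lists (D \<times> \<rat>))"
  show ?thesis
  proof (rule that)
    show "countable Q"
      unfolding Q_def using D(1) by (intro countable_image countable_SIGMA countable_lists countable_rat) auto
    have "\<exists>q\<in>Q. \<forall>x. \<bar>h x - q x\<bar> < e"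
      if h: "continuous_on UNIV h" "(h \<longlongrightarrow> 0) at_infinity" "0 < e" for h :: "'a \<Rightarrow> real" and e
    proof -
      obtain k L where "L \<in> lists (D \<times> \<rat>)" "\<forall>x. \<bar>h x - step_fun (inverse (Suc k)) L x\<bar> < e"
        using step_fun_approximation[OF h D(2)] by metis
      then show ?thesis unfolding Q_def by (intro bexI[of _ "step_fun (inverse (Suc k)) L"]) auto
    qed
    then show "\<forall>h. continuous_on UNIV h \<longrightarrow> (h \<longlongrightarrow> 0) at_infinity \<longrightarrow> (\<forall>e>0. \<exists>q\<in>Q. \<forall>x. \<bar>h x - q x\<bar> < e)"
      by blast
  qed
qed

lemma partial_derivs_diff:
  assumes "f \<in> C_space l" "g \<in> C_space l" "length is \<le> l"
  shows "partial_derivs is (\<lambda>x. f x - g x) x = partial_derivs is f x - partial_derivs is g x"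
  using partial_derivs_add[OF assms(1) C_space_mult[OF C_space_const[of "-1"] assms(2)] assms(3)]
    partial_derivs_cmult[OF assms(2,3), of "-1"] by simp

text \<open>The step functions approximate but do not belong to \<open>A\<close>. They are used as
  labels: a step function for each derivative and a precision \<open>k\<close> form a pattern, and
  one member of \<open>A\<close> is chosen for every pattern that some member fits. Two members
  fitting the same pattern differ by less than \<open>2 / (k + 1)\<close> in each
  derivative.\<close>

lemma countable_C_dense_subset:
  fixes A :: "(real^'n::finite \<Rightarrow> real) set"
  assumes A: "A \<subseteq> C0_space l"
  obtains S where "countable S" "S \<subseteq> A" "\<forall>f\<in>A. \<forall>e>0. \<exists>g\<in>S. derivs_bounded l (\<lambda>x. g x - f x) e"
proof -
  obtain Q :: "(real^'n \<Rightarrow> real) set" where Q: "countable Q"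
    "\<forall>h. continuous_on UNIV h \<longrightarrow> (h \<longlongrightarrow> 0) at_infinity \<longrightarrow> (\<forall>e>0. \<exists>q\<in>Q. \<forall>x. \<bar>h x - q x\<bar> < e)"
    using countable_uniformly_dense_C0 .
  define I where "I = {is :: 'n list. length is \<le> l}"
  define P where "P = (\<lambda>(F, k) f. f \<in> A \<and> (\<forall>is\<in>I. \<forall>x. \<bar>partial_derivs is f x - F is x\<bar> < inverse (real (Suc k))))"
  define T where "T = {p \<in> PiE I (\<lambda>_. Q) \<times> (UNIV :: nat set). \<exists>f. P p f}"
  define S where "S = (\<lambda>p. SOME f. P p f) ` T"
  have P: "P p (SOME f. P p f)" if "p \<in> T" for p
    using that unfolding T_def by (intro someI_ex[of "P p"]) simp
  show ?thesis
  proof (rule that)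
    have "countable (PiE I (\<lambda>_. Q))" using Q(1) by (intro countable_PiE) (auto simp: I_def)
    then have "countable T" unfolding T_def by (auto intro!: countable_Collect countable_SIGMA)
    then show "countable S" unfolding S_def by blast
    show "S \<subseteq> A" using P unfolding S_def P_def by auto
    show "\<forall>f\<in>A. \<forall>e>0. \<exists>g\<in>S. derivs_bounded l (\<lambda>x. g x - f x) e"
    proof (intro ballI allI impI)
      fix f and e :: real assume f: "f \<in> A" and e: "0 < e"
      obtain k where k: "inverse (real (Suc k)) < e / 2" using reals_Archimedean[of "e / 2"] e by auto
      have "\<forall>is\<in>I. \<exists>q\<in>Q. \<forall>x. \<bar>partial_derivs is f x - q x\<bar> < inverse (real (Suc k))"
        using f A by (intro ballI Q(2)[rule_format]) (auto simp: I_def C0_space_def C_space_def)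
      then obtain q where q: "\<forall>is\<in>I. q is \<in> Q \<and> (\<forall>x. \<bar>partial_derivs is f x - q is x\<bar> < inverse (real (Suc k)))"
        by metis
      define p where "p = (restrict q I, k)"
      have "P p f" using q f by (auto simp: P_def p_def)
      then have "p \<in> T" using q by (auto simp: T_def p_def)
      define g where "g = (SOME f. P p f)"
      have "P p g" unfolding g_def by (rule P[OF \<open>p \<in> T\<close>])
      have gf: "g \<in> C_space l" "f \<in> C_space l"
        using f \<open>P p g\<close> A C0_space_C_space by (auto simp: P_def p_def)
      have "derivs_bounded l (\<lambda>x. g x - f x) e"
        unfolding derivs_bounded_def
      proof (intro allI impI)
        fix "is" :: "'n list" and x assume l: "length is \<le> l"
        have "\<bar>partial_derivs is f x - q is x\<bar> < inverse (real (Suc k))"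
          using q l by (simp add: I_def)
        moreover have "\<bar>partial_derivs is g x - q is x\<bar> < inverse (real (Suc k))"
          using \<open>P p g\<close> l by (auto simp: P_def p_def I_def)
        ultimately show "\<bar>partial_derivs is (\<lambda>x. g x - f x) x\<bar> \<le> e"
          using k unfolding partial_derivs_diff[OF gf l] by linarith
      qed
      then show "\<exists>g\<in>S. derivs_bounded l (\<lambda>x. g x - f x) e"
        using \<open>p \<in> T\<close> unfolding S_def g_def by blast
    qed
  qed
qed

text \<open>The factor 2 turns the non-strict comparison of bound and norm into a strict
  one.\<close>

lemma C_norm_less:
  fixes f :: "real^'n::finite \<Rightarrow> real"
  assumes "derivs_bounded l f (e / (2 * num_derivs TYPE('n) l))" "0 < e"
  shows "C_norm l f < e"
  using C_norm_le[OF assms(1)] assms(2) num_derivs_pos[where 'n='n, of l] by simp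

text \<open>Choosing inside the compactly supported part of the ball keeps the family in
  \<open>Cc_space\<close>; that this part is dense in the whole ball accounts for the second
  \<open>e / 2\<close>.\<close>

lemma countable_dense_ball:
  obtains S :: "(real^'n::finite \<Rightarrow> real) set" where "countable S" "S \<subseteq> Cc_space l"
    "\<forall>f\<in>S. C_norm l f \<le> 1"
    "\<forall>f\<in>C0_unit_ball l. \<forall>e>0. \<exists>g\<in>S. derivs_bounded l (\<lambda>x. g x - f x) e"
proof -
  define A where "A = {f \<in> Cc_space l. C_norm l (f :: real^'n \<Rightarrow> real) \<le> 1}"
  have AC: "A \<subseteq> C0_space l" using Cc_space_subset_C0_space by (auto simp: A_def)
  obtain S where S: "countable S" "S \<subseteq> A"
    "\<forall>f\<in>A. \<forall>e>0. \<exists>g\<in>S. derivs_bounded l (\<lambda>x. g x - f x) e"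
    using countable_C_dense_subset[OF AC] .
  show ?thesis
  proof (rule that)
    show "countable S" "S \<subseteq> Cc_space l" "\<forall>f\<in>S. C_norm l f \<le> 1"
      using S(1,2) by (auto simp: A_def)
    show "\<forall>f\<in>C0_unit_ball l. \<forall>e>0. \<exists>g\<in>S. derivs_bounded l (\<lambda>x. g x - f x) e"
    proof (intro ballI allI impI)
      fix f :: "real^'n \<Rightarrow> real" and e :: real assume f: "f \<in> C0_unit_ball l" and e: "0 < e"
      have e2: "0 < e / 2" using e by simp
      obtain h where h: "h \<in> Cc_space l" "C_norm l h \<le> 1" "derivs_bounded l (\<lambda>x. h x - f x) (e / 2)"
        using C_norm_dense_ball[OF f e2] .
      obtain g where g: "g \<in> S" "derivs_bounded l (\<lambda>x. g x - h x) (e / 2)"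
        using S(3)[rule_format, OF _ e2, of h] h by (auto simp: A_def)
      have C: "g \<in> C_space l" "h \<in> C_space l" "f \<in> C_space l"
        using g(1) S(2) h(1) f by (auto simp: A_def Cc_space_def C0_unit_ball_def C0_space_def)
      have "derivs_bounded l (\<lambda>x. g x - f x) e"
        unfolding derivs_bounded_def
      proof (intro allI impI)
        fix "is" :: "'n list" and x assume l: "length is \<le> l"
        have "\<bar>partial_derivs is h x - partial_derivs is f x\<bar> \<le> e / 2"
          using h(3) l unfolding derivs_bounded_def partial_derivs_diff[OF C(2,3) l, symmetric] by simp
        moreover have "\<bar>partial_derivs is g x - partial_derivs is h x\<bar> \<le> e / 2"
          using g(2) l unfolding derivs_bounded_def partial_derivs_diff[OF C(1,2) l, symmetric] by simp
        ultimately show "\<bar>partial_derivs is (\<lambda>x. g x - f x) x\<bar> \<le> e"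
          unfolding partial_derivs_diff[OF C(1,3) l] by linarith
      qed
      then show "\<exists>g\<in>S. derivs_bounded l (\<lambda>x. g x - f x) e" using g(1) by blast
    qed
  qed
qed

section \<open>A space-filling curve with a Borel section\<close>

text \<open>A trigonometric version of Schoenberg's trapezoidal function: even, of period 2, equal
  to 0 on [0,1/3] and to 1 on [2/3,1], since the cosine is 1/2 and -1/2 at the inner end
  points.\<close>

definition wave :: "real \<Rightarrow> real" where
  "wave t = max 0 (min 1 (1 / 2 - cos (pi * t)))"

text \<open>For a 0-1 sequence \<open>a\<close> this is the point of the Cantor set with ternary
  digits \<open>2 * a k\<close>.\<close>

definition ternary :: "(nat \<Rightarrow> real) \<Rightarrow> real" where
  "ternary a = (\<Sum>k. 2 * a k / 3 ^ Suc k)"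

text \<open>The digit of weight \<open>1 / 2 ^ Suc k\<close>; written with floors it is visibly a
  Borel function of \<open>y\<close>.\<close>

definition binary_digit :: "nat \<Rightarrow> real \<Rightarrow> real" where
  "binary_digit k y = of_int (\<lfloor>2 ^ Suc k * y\<rfloor> - 2 * \<lfloor>2 ^ k * y\<rfloor>)"

lemma wave_bounds: "0 \<le> wave t" "wave t \<le> 1"
  by (auto simp: wave_def)

lemma continuous_on_wave: "continuous_on UNIV wave"
  unfolding wave_def by (intro continuous_intros)

lemma sums_ternary_one: "(\<lambda>k. 2 / 3 ^ Suc k) sums (1 :: real)"
proof -
  have "(\<lambda>k. (2 / 3) * (1 / 3) ^ k) sums ((2 / 3) * (1 / (1 - 1 / 3 :: real)))"
    by (intro sums_mult geometric_sums) simp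
  then show ?thesis by (simp add: power_divide)
qed

lemma summable_ternary:
  assumes "\<And>k. a k \<in> {0, 1}"
  shows "summable (\<lambda>k. 2 * a k / 3 ^ Suc k :: real)"
proof (rule summable_comparison_test'[OF sums_summable[OF sums_ternary_one]])
  show "norm (2 * a k / 3 ^ Suc k) \<le> 2 / 3 ^ Suc k" for k
    using assms[of k] by auto
qed

lemma ternary_bounds:
  assumes "\<And>k. a k \<in> {0, 1}"
  shows "0 \<le> ternary a" "ternary a \<le> 1"
proof -
  have "0 \<le> 2 * a k / 3 ^ Suc k" "2 * a k / 3 ^ Suc k \<le> 2 / 3 ^ Suc k" for k
    using assms[of k] by auto
  then show "0 \<le> ternary a" "ternary a \<le> 1"
    unfolding ternary_def sums_unique[OF sums_ternary_one]
    using summable_ternary[OF assms] sums_summable[OF sums_ternary_one]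
    by (auto intro!: suminf_nonneg suminf_le)
qed

lemma ternary_Suc:
  assumes "\<And>k. a k \<in> {0, 1}"
  shows "3 * ternary a = 2 * a 0 + ternary (\<lambda>k. a (Suc k))"
proof -
  have "(\<Sum>k. 2 * a (Suc k) / 3 ^ Suc (Suc k)) = ternary (\<lambda>k. a (Suc k)) / 3"
    unfolding ternary_def using summable_ternary[of "\<lambda>k. a (Suc k)"] assms
    by (subst suminf_divide[symmetric]) (auto simp: algebra_simps)
  then show ?thesis
    using suminf_split_head[OF summable_ternary[of a]] assms by (simp add: ternary_def)
qed

text \<open>As all ternary digits are even, \<open>3 ^ m * ternary a\<close> is an even integer plus
  a Cantor point \<open>u\<close> whose leading digit is \<open>2 * a m\<close>. The period 2
  discards the integer, and the leading digit places \<open>u\<close> in [0,1/3] or in [2/3,1],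
  where \<open>wave\<close> is constant.\<close>

lemma wave_ternary:
  assumes "\<And>k. a k \<in> {0, 1}"
  shows "wave (3 ^ m * ternary a) = a m"
proof -
  have "\<exists>N::nat. 3 ^ m * ternary a = 2 * real N + ternary (\<lambda>k. a (m + k))"
  proof (induction m)
    case 0
    then show ?case by (auto intro: exI[of _ 0])
  next
    case (Suc m)
    then obtain N where N: "3 ^ m * ternary a = 2 * real N + ternary (\<lambda>k. a (m + k))" by blast
    obtain e :: nat where e: "a m = real e" using assms[of m] by (metis insertE of_nat_0 of_nat_1 singletonD)
    have "3 ^ Suc m * ternary a = 2 * real (3 * N + e) + ternary (\<lambda>k. a (Suc m + k))"
      using N ternary_Suc[of "\<lambda>k. a (m + k)"] assms e by simp
    then show ?case by blast
  qed
  then obtain N :: nat where N: "3 ^ m * ternary a = 2 * real N + ternary (\<lambda>k. a (m + k))" by blast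
  define u where "u = ternary (\<lambda>k. a (m + k))"
  have "cos (pi * (3 ^ m * ternary a)) = cos (2 * real N * pi + pi * u)"
    unfolding N u_def by (simp add: algebra_simps)
  also have "\<dots> = cos (pi * u)" unfolding cos_add by simp
  finally have c: "cos (pi * (3 ^ m * ternary a)) = cos (pi * u)" .
  have u: "3 * u = 2 * a m + ternary (\<lambda>k. a (m + Suc k))"
    using ternary_Suc[of "\<lambda>k. a (m + k)"] assms by (simp add: u_def)
  have b: "0 \<le> ternary (\<lambda>k. a (m + Suc k))" "ternary (\<lambda>k. a (m + Suc k)) \<le> 1"
    using ternary_bounds[of "\<lambda>k. a (m + Suc k)"] assms by auto
  consider "a m = 0" | "a m = 1" using assms[of m] by blast
  then show ?thesis
  proof cases
    case 1
    then have "0 \<le> u" "u \<le> 1 / 3" using u b by auto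
    then have "cos (pi * (1 / 3)) \<le> cos (pi * u)" by (intro cos_monotone_0_pi_le) (auto intro: mult_left_mono)
    then show ?thesis using 1 by (simp add: wave_def c cos_60)
  next
    case 2
    then have "2 / 3 \<le> u" "u \<le> 1" using u b by auto
    then have "cos (pi * u) \<le> cos (pi * (2 / 3))" by (intro cos_monotone_0_pi_le) auto
    moreover have "cos (pi * (2 / 3)) = - 1 / 2" using cos_120 by (simp add: algebra_simps)
    ultimately show ?thesis using 2 by (simp add: wave_def c)
  qed
qed

lemma binary_digit: "binary_digit k y \<in> {0, 1}"
proof -
  have "\<lfloor>2 ^ Suc k * y\<rfloor> - 2 * \<lfloor>2 ^ k * y\<rfloor> \<in> {0, 1}"
    using floor_correct[of "2 ^ Suc k * y"] floor_correct[of "2 ^ k * y"] by auto linarith+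
  then show ?thesis unfolding binary_digit_def by auto
qed

text \<open>The partial sums telescope to \<open>\<lfloor>2 ^ K * y\<rfloor> / 2 ^ K\<close>, the
  initial floor being 0 as \<open>y\<close> lies in [0,1).\<close>

lemma sums_binary_digits:
  assumes "0 \<le> y" "y < 1"
  shows "(\<lambda>k. binary_digit k y / 2 ^ Suc k) sums y"
proof -
  have p: "(\<Sum>k<K. binary_digit k y / 2 ^ Suc k) = of_int \<lfloor>2 ^ K * y\<rfloor> / 2 ^ K" for K
  proof (induction K)
    case 0
    have "\<lfloor>y\<rfloor> = 0" using assms by linarith
    then show ?case by simp
  next
    case (Suc K)
    then show ?case by (simp add: binary_digit_def field_simps)
  qed
  have "(\<lambda>K. of_int \<lfloor>2 ^ K * y\<rfloor> / 2 ^ K) \<longlonglongrightarrow> y"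
  proof (rule tendsto_sandwich)
    show "\<forall>\<^sub>F K in sequentially. y - (1 / 2) ^ K \<le> of_int \<lfloor>2 ^ K * y\<rfloor> / 2 ^ K"
    proof (intro always_eventually allI)
      fix K
      have "2 ^ K * y - 1 \<le> of_int \<lfloor>2 ^ K * y\<rfloor>" by linarith
      then have "(2 ^ K * y - 1) / 2 ^ K \<le> of_int \<lfloor>2 ^ K * y\<rfloor> / 2 ^ K" by (rule divide_right_mono) simp
      then show "y - (1 / 2) ^ K \<le> of_int \<lfloor>2 ^ K * y\<rfloor> / 2 ^ K" by (simp add: diff_divide_distrib power_divide)
    qed
    show "\<forall>\<^sub>F K in sequentially. of_int \<lfloor>2 ^ K * y\<rfloor> / 2 ^ K \<le> y"
    proof (intro always_eventually allI)
      fix K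
      have "of_int \<lfloor>2 ^ K * y\<rfloor> / 2 ^ K \<le> (2 ^ K * y) / 2 ^ K" by (rule divide_right_mono) auto
      then show "of_int \<lfloor>2 ^ K * y\<rfloor> / 2 ^ K \<le> y" by simp
    qed
    have "(\<lambda>K. y - (1 / 2 :: real) ^ K) \<longlonglongrightarrow> y - 0" by (intro tendsto_intros LIMSEQ_power_zero) simp
    then show "(\<lambda>K. y - (1 / 2) ^ K) \<longlonglongrightarrow> y" by simp
  qed simp
  then show ?thesis unfolding sums_def p .
qed

text \<open>Schoenberg's construction: the ternary digits of the parameter are the binary digits of all
  coordinates, indexed by pairs of a coordinate and a position.\<close>

definition curve_coord :: "'n::finite \<Rightarrow> real \<Rightarrow> real" where
  "curve_coord i t = (\<Sum>k. wave (3 ^ to_nat (i, k) * t) / 2 ^ Suc k)"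

definition section_param :: "real^'n::finite \<Rightarrow> real" where
  "section_param y = ternary (\<lambda>m. case from_nat m of (i, k) \<Rightarrow> binary_digit k (y $ i))"

lemma continuous_on_curve_coord: "continuous_on UNIV (curve_coord i)"
proof -
  have "uniform_limit UNIV (\<lambda>K t. \<Sum>k<K. wave (3 ^ to_nat (i, k) * t) / 2 ^ Suc k) (curve_coord i) sequentially"
    unfolding curve_coord_def[abs_def]
  proof (rule Weierstrass_m_test)
    show "summable (\<lambda>k. 1 / 2 ^ Suc k :: real)" using sums_summable[OF power_half_series] by (simp add: power_divide)
    show "norm (wave (3 ^ to_nat (i, k) * t) / 2 ^ Suc k) \<le> 1 / 2 ^ Suc k" for k t
      using wave_bounds by (simp add: divide_right_mono)
  qed
  then show ?thesis
    by (rule uniform_limit_theorem[rotated])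
      (auto intro!: always_eventually continuous_intros continuous_on_compose2[OF continuous_on_wave])
qed

text \<open>At frequency \<open>3 ^ to_nat (i, k)\<close> the wave reads off the ternary digit in
  which the \<open>k\<close>-th binary digit of coordinate \<open>i\<close> was stored.\<close>

lemma curve_coord_section_param:
  assumes "0 \<le> y $ i" "y $ i < 1"
  shows "curve_coord i (section_param y) = y $ i"
proof -
  let ?a = "\<lambda>m. case from_nat m of (i, k) \<Rightarrow> binary_digit k (y $ i)"
  have "?a m \<in> {0, 1}" for m using binary_digit by (cases "from_nat m :: 'a \<times> nat") auto
  then have "wave (3 ^ to_nat (i, k) * section_param y) = binary_digit k (y $ i)" for k
    unfolding section_param_def by (subst wave_ternary) auto
  then show ?thesis
    unfolding curve_coord_def using sums_unique[OF sums_binary_digits[OF assms]] by simp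
qed

lemma section_param_bounds: "section_param y \<in> {0..1}"
proof -
  have "(case from_nat m of (i, k) \<Rightarrow> binary_digit k (y $ i)) \<in> {0, 1}" for m
    using binary_digit by (cases "from_nat m :: 'a \<times> nat") auto
  then show ?thesis unfolding section_param_def using ternary_bounds by auto
qed

lemma borel_measurable_section_param: "section_param \<in> borel_measurable borel"
proof -
  have "(\<lambda>y::real^'a. case from_nat m of (i, k) \<Rightarrow> binary_digit k (y $ i)) \<in> borel_measurable borel" for m
    unfolding binary_digit_def
    by (cases "from_nat m :: 'a \<times> nat") (simp, measurable)
  then show ?thesis unfolding section_param_def[abs_def] ternary_def by measurable
qed

text \<open>An affine change of coordinates makes the cube [-1,1]^n. The open unit ball stays off
  its faces, so the rescaled coordinates are below 1, where the binary expansion is valid.\<close>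

lemma curve_with_section:
  obtains g :: "real \<Rightarrow> real^'n::finite" and s where "continuous_on UNIV g"
    "s \<in> borel_measurable borel" "\<And>y. s y \<in> {0..1}" "\<And>y. norm y < 1 \<Longrightarrow> g (s y) = y"
proof
  let ?g = "\<lambda>t. \<chi> i. 2 * curve_coord i t - 1"
  let ?h = "\<lambda>y::real^'n. \<chi> i. (y $ i + 1) / 2"
  let ?s = "\<lambda>y. section_param (?h y)"
  show "continuous_on UNIV ?g"
    by (intro continuous_on_vec_lambda continuous_intros continuous_on_curve_coord)
  have "continuous_on UNIV ?h" by (intro continuous_on_vec_lambda continuous_intros) auto
  then have "?h \<in> borel_measurable borel" by (rule borel_measurable_continuous_onI)
  then show "?s \<in> borel_measurable borel"
    by (rule measurable_compose[OF _ borel_measurable_section_param])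
  show "?s y \<in> {0..1}" for y by (rule section_param_bounds)
  show "?g (?s y) = y" if "norm y < 1" for y
  proof -
    have "\<bar>y $ i\<bar> < 1" for i using that component_le_norm_cart[of y i] by linarith
    then have c: "curve_coord i (?s y) = (y $ i + 1) / 2" for i
      using curve_coord_section_param[of "?h y" i] by (auto simp: abs_less_iff) (smt (verit))
    have "2 * curve_coord i (?s y) - 1 = y $ i" for i using c[of i] by simp
    then show ?thesis by (simp only: vec_eq_iff vec_lambda_beta) simp
  qed
qed

section \<open>Vague compactness\<close>

lemma finite_borel_measuresD:
  assumes "\<mu> \<in> finite_borel_measures"
  shows "finite_measure \<mu>" "sets \<mu> = sets borel" "space \<mu> = UNIV"
  using assms sets_eq_imp_space_eq[of \<mu> borel] by (auto simp: finite_borel_measures_def)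

lemma integrable_bounded_continuous:
  fixes f :: "real^'n::finite \<Rightarrow> real"
  assumes "\<mu> \<in> finite_borel_measures" "continuous_on UNIV f" "\<And>x. \<bar>f x\<bar> \<le> B"
  shows "integrable \<mu> f"
proof -
  interpret finite_measure \<mu> using finite_borel_measuresD[OF assms(1)] by simp
  have "f \<in> borel_measurable \<mu>"
    using borel_measurable_continuous_onI[OF assms(2)] finite_borel_measuresD(2)[OF assms(1)]
    by (simp cong: measurable_cong_sets)
  then show ?thesis by (intro integrable_const_bound[where B = B]) (use assms(3) in auto)
qed

lemma unit_interval_weak_compactness:
  assumes "\<And>k. real_distribution (\<nu> k)" "\<And>k. measure (\<nu> k) {0..1} = 1"
  obtains r L where "strict_mono (r :: nat \<Rightarrow> nat)" "real_distribution L"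
    "\<forall>h :: real \<Rightarrow> real. continuous_on UNIV h \<and> bounded (range h) \<longrightarrow> (\<lambda>k. integral\<^sup>L (\<nu> (r k)) h) \<longlonglongrightarrow> integral\<^sup>L L h"
proof -
  \<comment> \<open>Tightness is expressed with half-open intervals; the left end point -1 makes the
    interval contain the point 0.\<close>
  have m: "1 \<le> measure (\<nu> k) {-1<..1}" for k
  proof -
    interpret real_distribution "\<nu> k" by (rule assms(1))
    have "measure (\<nu> k) {0..1} \<le> measure (\<nu> k) {-1<..1}" by (intro finite_measure_mono) auto
    then show ?thesis using assms(2) by simp
  qed
  have "tight \<nu>"
    unfolding tight_def
  proof (intro conjI allI impI)
    show "\<exists>a b. a < b \<and> (\<forall>n. 1 - \<epsilon> < measure (\<nu> n) {a<..b})" if "0 < \<epsilon>" for \<epsilon>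
      using m that by (intro exI[of _ "-1"] exI[of _ 1]) (auto intro: less_le_trans[of _ 1])
  qed (rule assms(1))
  then obtain r L where r: "strict_mono r" "real_distribution L" "weak_conv_m (\<nu> \<circ> id \<circ> r) L"
    using tight_imp_convergent_subsubsequence[of \<nu> id] strict_mono_id by blast
  have "(\<lambda>k. integral\<^sup>L (\<nu> (r k)) h) \<longlonglongrightarrow> integral\<^sup>L L h"
    if "continuous_on UNIV h" and b: "bounded (range h)" for h :: "real \<Rightarrow> real"
  proof -
    obtain B where "\<And>x. norm (h x) \<le> B" using b by (auto simp: bounded_iff)
    moreover have "isCont h x" for x using that(1) by (simp add: continuous_on_eq_continuous_at)
    moreover have "weak_conv_m (\<lambda>k. \<nu> (r k)) L" using r(3) by (simp add: comp_def)
    ultimately have "(\<lambda>k. integral\<^sup>L (\<nu> (r k)) h) \<longlonglongrightarrow> integral\<^sup>L L h"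
      using r(2) assms(1) by (intro weak_conv_imp_integral_bdd_continuous_conv[where B = B]) auto
    then show ?thesis by simp
  qed
  then show ?thesis using that r by blast
qed

text \<open>Helly's theorem concerns probability distributions. The total mass is kept as a separate
  factor, so masses and normalized images can be made to converge one after the other.\<close>

lemma normalized_image:
  fixes s :: "real^'n::finite \<Rightarrow> real"
  assumes \<mu>: "\<mu> \<in> finite_borel_measures" and s: "s \<in> borel_measurable borel" "\<And>x. s x \<in> {0..1}"
  obtains \<nu> where "real_distribution \<nu>" "measure \<nu> {0..1} = 1"
    "\<forall>h \<in> borel_measurable borel. measure \<mu> UNIV * integral\<^sup>L \<nu> h = (\<integral>x. h (s x) \<partial>\<mu> :: real)"
proof -
  interpret finite_measure \<mu> using finite_borel_measuresD[OF \<mu>] by simp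
  have sp: "space \<mu> = UNIV" and se: "sets \<mu> = sets borel" using finite_borel_measuresD[OF \<mu>] by auto
  have sm: "s \<in> borel_measurable \<mu>" using s(1) se by (simp cong: measurable_cong_sets)
  define m where "m = measure \<mu> UNIV"
  show ?thesis
  proof (cases "m = 0")
    \<comment> \<open>A measure of mass 0 cannot be normalized. Both sides of the identity are then
      0, and a point mass at 0 serves as distribution.\<close>
    case True
    have "emeasure \<mu> (space \<mu>) = 0" using True sp by (simp add: m_def emeasure_eq_measure)
    then have AE: "AE x in \<mu>. P x" for P
      by (intro AE_I[of _ _ "space \<mu>"]) auto
    have "(\<integral>x. h (s x) \<partial>\<mu>) = 0" for h :: "real \<Rightarrow> real"
      by (rule integral_eq_zero_AE) (rule AE)
    moreover have "real_distribution (return borel (0::real))"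
      by (auto simp: real_distribution_def real_distribution_axioms_def prob_space_return)
    moreover have "measure (return borel (0::real)) {0..1} = 1" by (simp add: measure_return)
    ultimately show ?thesis using that[of "return borel 0"] True m_def by simp
  next
    case False
    then have m: "0 < m" by (simp add: m_def zero_less_measure_iff)
    define \<kappa> where "\<kappa> = density \<mu> (\<lambda>x. ennreal (1 / m))"
    have "emeasure \<kappa> (space \<kappa>) = 1"
      using m emeasure_density_const[of UNIV \<mu> "ennreal (1 / m)"]
      by (simp add: \<kappa>_def emeasure_eq_measure sp se m_def[symmetric] ennreal_mult[symmetric])
    then interpret k: prob_space \<kappa> by (rule prob_spaceI)
    have skm: "s \<in> borel_measurable \<kappa>" using sm by (simp add: \<kappa>_def)
    have eq: "m * integral\<^sup>L (distr \<kappa> borel s) h = (\<integral>x. h (s x) \<partial>\<mu>)" if "h \<in> borel_measurable borel" for h :: "real \<Rightarrow> real"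
      using m sm that by (simp add: integral_distr skm \<kappa>_def integral_density)
    have "measure (distr \<kappa> borel s) {0..1} = 1"
      using s(2) by (simp add: measure_distr skm vimage_def k.prob_space)
    then show ?thesis
      using that[of "distr \<kappa> borel s"] k.real_distribution_distr[OF skm] eq by (simp add: m_def)
  qed
qed

text \<open>As \<open>norm (g t)\<close> rises to 1 the argument of \<open>f\<close> escapes to
  infinity, where \<open>f\<close> tends to 0; hence the extension by 0 is continuous across the
  boundary.\<close>

lemma continuous_on_extend_zero_at_infinity:
  fixes g :: "real \<Rightarrow> 'a::euclidean_space" and f :: "'a \<Rightarrow> real"
  assumes g: "continuous_on UNIV g" and f: "continuous_on UNIV f" "(f \<longlongrightarrow> 0) at_infinity"
  shows "continuous_on UNIV (\<lambda>t. if norm (g t) < 1 then f (g t /\<^sub>R (1 - norm (g t))) else 0)" (is "continuous_on UNIV ?H")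
proof -
  have gc: "isCont g t" for t using g by (simp add: continuous_on_eq_continuous_at)
  have "isCont ?H t" for t
  proof (cases "norm (g t) < 1")
    case True
    let ?U = "{t. norm (g t) < 1}"
    have U: "open ?U" using g by (intro open_Collect_less continuous_on_norm continuous_on_const)
    have "continuous_on ?U (\<lambda>t. g t /\<^sub>R (1 - norm (g t)))"
      using continuous_on_subset[OF g] by (intro continuous_intros) auto
    then have "continuous_on ?U (\<lambda>t. f (g t /\<^sub>R (1 - norm (g t))))"
      by (rule continuous_on_compose2[OF f(1)]) simp
    then have "continuous_on ?U ?H" by (rule continuous_on_eq) simp
    then show ?thesis using U True by (simp add: continuous_on_eq_continuous_at)
  next
    case False
    have "(?H \<longlongrightarrow> 0) (at t)"
      unfolding tendsto_iff
    proof (intro allI impI)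
      fix e :: real assume e: "0 < e"
      obtain b where b: "\<And>x. norm x \<ge> b \<Longrightarrow> \<bar>f x\<bar> < e"
        using f(2)[unfolded tendsto_iff, rule_format, OF e] by (auto simp: eventually_at_infinity)
      define c where "c = max b 0"
      have "0 \<le> c" by (simp add: c_def)
      have "((\<lambda>t. norm (g t)) \<longlongrightarrow> norm (g t)) (at t)"
        using gc[of t] by (intro tendsto_intros) (simp add: continuous_at)
      \<comment> \<open>The function \<open>r \<mapsto> r / (1 - r)\<close> takes the value
        \<open>c\<close> at \<open>c / (1 + c)\<close>, so beyond this radius the argument of
        \<open>f\<close> has norm at least \<open>c \<ge> b\<close>.\<close>
      moreover have "c / (1 + c) < norm (g t)"
        using False \<open>0 \<le> c\<close> by (auto intro: less_le_trans[where y = 1 and x = "c / (1 + c)"])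
      ultimately have "\<forall>\<^sub>F u in at t. c / (1 + c) < norm (g u)" by (rule order_tendstoD(1))
      then show "\<forall>\<^sub>F u in at t. dist (?H u) 0 < e"
      proof eventually_elim
        case (elim u)
        show ?case
        proof (cases "norm (g u) < 1")
          case True
          have "c \<le> norm (g u) / (1 - norm (g u))"
            using elim True \<open>0 \<le> c\<close> by (simp add: field_simps)
          also have "\<dots> = norm (g u /\<^sub>R (1 - norm (g u)))" using True by (simp add: field_simps)
          finally have "b \<le> norm (g u /\<^sub>R (1 - norm (g u)))" by (simp add: c_def)
          then show ?thesis using b True by simp
        qed (use e in simp)
      qed
    qed
    then show ?thesis using False by (simp add: continuous_at)
  qed
  then show ?thesis by (simp add: continuous_on_eq_continuous_at)
qed

text \<open>Contracting \<open>\<real>\<^sup>n\<close> to its open unit ball and lifting along the section of the curve turns the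
  measures into distributions on \<open>[0,1]\<close>, to which Helly's theorem applies. Mass that the limit puts
  outside the open ball is lost at infinity, where the test functions vanish.\<close>

lemma vague_compactness:
  fixes \<mu> :: "nat \<Rightarrow> (real^'n::finite) measure"
  assumes \<mu>: "\<And>k. \<mu> k \<in> finite_borel_measures" and B: "\<And>k. measure (\<mu> k) UNIV \<le> B"
  obtains r \<mu>' where "strict_mono (r :: nat \<Rightarrow> nat)" "\<mu>' \<in> finite_borel_measures"
    "\<forall>f :: real^'n \<Rightarrow> real. continuous_on UNIV f \<and> (f \<longlongrightarrow> 0) at_infinity \<longrightarrow> (\<lambda>k. integral\<^sup>L (\<mu> (r k)) f) \<longlonglongrightarrow> integral\<^sup>L \<mu>' f"
proof -
  obtain g :: "real \<Rightarrow> real^'n" and s where g: "continuous_on UNIV g"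
    and s: "s \<in> borel_measurable borel" "\<And>y. s y \<in> {0..1}" "\<And>y. norm y < 1 \<Longrightarrow> g (s y) = y"
    using curve_with_section by metis
  \<comment> \<open>A radial homeomorphism onto the open unit ball with inverse
    \<open>y \<mapsto> y / (1 - norm y)\<close>.\<close>
  define E where "E = (\<lambda>x :: real^'n. x /\<^sub>R (1 + norm x))"
  have pos: "0 < 1 + norm x" for x :: "real^'n" by (simp add: add_pos_nonneg)
  have norm_E: "norm (E x) = norm x / (1 + norm x)" for x
    using pos[of x] by (simp add: E_def field_simps)
  then have E1: "norm (E x) < 1" for x using pos[of x] by simp
  have E_inv: "E x /\<^sub>R (1 - norm (E x)) = x" for x
  proof -
    have "1 - norm (E x) = 1 / (1 + norm x)" using pos[of x] by (simp add: norm_E field_simps)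
    then show ?thesis using pos[of x] by (simp add: E_def)
  qed
  have "continuous_on UNIV E"
    unfolding E_def using pos by (intro continuous_intros) (auto simp: less_imp_neq[symmetric])
  then have Em: "E \<in> borel_measurable borel" by (rule borel_measurable_continuous_onI)
  have sE: "(\<lambda>x. s (E x)) \<in> borel_measurable borel" by (rule measurable_compose[OF Em s(1)])
  have "\<forall>k. \<exists>\<nu>. real_distribution \<nu> \<and> measure \<nu> {0..1} = 1 \<and>
    (\<forall>h \<in> borel_measurable borel. measure (\<mu> k) UNIV * integral\<^sup>L \<nu> h = (\<integral>x. h (s (E x)) \<partial>\<mu> k :: real))"
  proof
    fix k
    obtain \<nu> where "real_distribution \<nu>" "measure \<nu> {0..1} = 1"
      "\<forall>h \<in> borel_measurable borel. measure (\<mu> k) UNIV * integral\<^sup>L \<nu> h = (\<integral>x. h (s (E x)) \<partial>\<mu> k :: real)"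
      using normalized_image[OF \<mu>[of k] sE s(2)] .
    then show "\<exists>\<nu>. real_distribution \<nu> \<and> measure \<nu> {0..1} = 1 \<and>
      (\<forall>h \<in> borel_measurable borel. measure (\<mu> k) UNIV * integral\<^sup>L \<nu> h = (\<integral>x. h (s (E x)) \<partial>\<mu> k :: real))"
      by blast
  qed
  then obtain \<nu> where \<nu>: "\<And>k. real_distribution (\<nu> k)" "\<And>k. measure (\<nu> k) {0..1} = 1"
    "\<And>k h. h \<in> borel_measurable borel \<Longrightarrow> measure (\<mu> k) UNIV * integral\<^sup>L (\<nu> k) h = (\<integral>x. h (s (E x)) \<partial>\<mu> k :: real)"
    unfolding choice_iff by auto
  obtain r1 L where r1: "strict_mono r1" and L: "real_distribution L"
    and conv: "\<forall>h :: real \<Rightarrow> real. continuous_on UNIV h \<and> bounded (range h) \<longrightarrow> (\<lambda>k. integral\<^sup>L (\<nu> (r1 k)) h) \<longlonglongrightarrow> integral\<^sup>L L h"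
    using unit_interval_weak_compactness[OF \<nu>(1,2)] .
  have "bounded (range (\<lambda>k. measure (\<mu> (r1 k)) UNIV))"
    using B by (auto simp: bounded_iff)
  then obtain m r2 where r2: "strict_mono r2" "((\<lambda>k. measure (\<mu> (r1 k)) UNIV) \<circ> r2) \<longlonglongrightarrow> m"
    using bounded_imp_convergent_subsequence by metis
  have m: "0 \<le> m" by (rule LIMSEQ_le_const[OF r2(2)]) auto
  interpret L: real_distribution L by (rule L)
  define A where "A = {t. norm (g t) < 1}"
  have A: "A \<in> sets borel" unfolding A_def using g by (intro borel_open open_Collect_less continuous_intros)
  \<comment> \<open>\<open>G\<close> undoes the contraction \<open>E\<close> along the curve, so
    that \<open>G (s (E x)) = x\<close>; the limit measure will be the image under \<open>G\<close>
    of \<open>L\<close> restricted to \<open>A\<close> and weighted by the limit mass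
    \<open>m\<close>.\<close>
  define G where "G = (\<lambda>t. if norm (g t) < 1 then g t /\<^sub>R (1 - norm (g t)) else 0)"
  have gm [measurable]: "g \<in> borel_measurable borel" by (rule borel_measurable_continuous_onI[OF g])
  have Gm [measurable]: "G \<in> borel_measurable borel" unfolding G_def by measurable
  have LA [measurable]: "A \<in> sets L" using A by simp
  define \<kappa> where "\<kappa> = density L (\<lambda>t. ennreal (m * indicator A t))"
  have GL: "G \<in> borel_measurable \<kappa>" using Gm by (simp add: \<kappa>_def)
  have "emeasure \<kappa> (space \<kappa>) \<le> (\<integral>\<^sup>+ t. ennreal m \<partial>L)"
    unfolding \<kappa>_def by (simp add: emeasure_density del: nn_integral_const)
      (intro nn_integral_mono, use m in \<open>auto simp: indicator_def\<close>)
  also have "\<dots> < \<infinity>" by (simp add: L.emeasure_space_1[simplified] ennreal_mult_less_top)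
  finally have "finite_measure \<kappa>" by (intro finite_measureI) auto
  then have fin: "distr \<kappa> borel G \<in> finite_borel_measures"
    unfolding finite_borel_measures_def by (auto intro: finite_measure.finite_measure_distr GL)
  have lim: "(\<lambda>k. integral\<^sup>L (\<mu> (r1 (r2 k))) f) \<longlonglongrightarrow> integral\<^sup>L (distr \<kappa> borel G) f"
    if f: "continuous_on UNIV f" "(f \<longlongrightarrow> 0) at_infinity" for f :: "real^'n \<Rightarrow> real"
  proof -
    define H where "H = (\<lambda>t. if norm (g t) < 1 then f (g t /\<^sub>R (1 - norm (g t))) else 0)"
    have Hc: "continuous_on UNIV H" unfolding H_def by (rule continuous_on_extend_zero_at_infinity[OF g f])
    have Hm: "H \<in> borel_measurable borel" by (rule borel_measurable_continuous_onI[OF Hc])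
    obtain K where K: "\<And>x. \<bar>f x\<bar> \<le> K" using bounded_of_tendsto_zero[OF f] by blast
    have "\<bar>H t\<bar> \<le> K" for t using K[of 0] K by (auto simp: H_def intro: order_trans[OF abs_ge_zero])
    then have Hb: "bounded (range H)" by (auto simp: bounded_iff)
    \<comment> \<open>Since \<open>s\<close> is a section on the open ball,
      \<open>g (s (E x)) = E x\<close>. Integrals of \<open>f\<close> over space thus become
      integrals of the continuous function \<open>H\<close> over the line, exactly and for every
      \<open>k\<close>.\<close>
    have HsE: "H (s (E x)) = f x" for x
      using E1[of x] E_inv[of x] s(3)[OF E1[of x]] by (simp add: H_def)
    have fm: "f \<in> borel_measurable borel" by (rule borel_measurable_continuous_onI[OF f(1)])
    have "(\<lambda>k. integral\<^sup>L (\<nu> (r1 k)) H) \<longlonglongrightarrow> integral\<^sup>L L H" using conv Hc Hb by blast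
    then have "((\<lambda>k. integral\<^sup>L (\<nu> (r1 k)) H) \<circ> r2) \<longlonglongrightarrow> integral\<^sup>L L H"
      using r2(1) by (rule LIMSEQ_subseq_LIMSEQ)
    with r2(2) have "(\<lambda>k. measure (\<mu> (r1 (r2 k))) UNIV * integral\<^sup>L (\<nu> (r1 (r2 k))) H) \<longlonglongrightarrow> m * integral\<^sup>L L H"
      unfolding comp_def by (rule tendsto_mult)
    moreover have "integral\<^sup>L (distr \<kappa> borel G) f = m * integral\<^sup>L L H"
    proof -
      have "integral\<^sup>L (distr \<kappa> borel G) f = (\<integral>t. f (G t) \<partial>\<kappa>)"
        by (rule integral_distr[OF GL fm])
      also have "\<dots> = (\<integral>t. (m * indicator A t) *\<^sub>R f (G t) \<partial>L)"
        unfolding \<kappa>_def using m measurable_compose[OF Gm fm] by (intro integral_density) auto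
      also have "\<dots> = (\<integral>t. m * H t \<partial>L)"
        by (intro Bochner_Integration.integral_cong) (auto simp: A_def G_def H_def)
      finally show ?thesis by simp
    qed
    ultimately show ?thesis by (simp add: \<nu>(3)[OF Hm] HsE)
  qed
  show ?thesis
    by (rule that[OF strict_mono_o[OF r1 r2(1)] fin]) (auto simp: comp_def intro: lim)
qed

section \<open>The unit ball\<close>

lemma C0_space_cmult:
  assumes "f \<in> C0_space l"
  shows "(\<lambda>x. c * f x) \<in> C0_space l"
proof -
  have f: "f \<in> C_space l" by (rule C0_space_C_space[OF assms])
  have "(partial_derivs is (\<lambda>x. c * f x) \<longlongrightarrow> 0) at_infinity" if "length is \<le> l" for "is"
    using assms that partial_derivs_cmult[OF f that, of c] tendsto_mult_left[of "partial_derivs is f" 0 at_infinity c]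
    by (simp add: C0_space_def)
  then show ?thesis using C_space_mult[OF C_space_const f] by (simp add: C0_space_def)
qed

lemma C0_unit_ballD:
  fixes f :: "real^'n::finite \<Rightarrow> real"
  assumes "f \<in> C0_unit_ball l"
  shows "f \<in> C0_space l" "derivs_bounded l f 1" "\<bar>f x\<bar> \<le> 1" "continuous_on UNIV f" "(f \<longlongrightarrow> 0) at_infinity"
proof -
  show f: "f \<in> C0_space l" using assms by (simp add: C0_unit_ball_def)
  obtain K where "derivs_bounded l f K" using C0_space_bounded[OF f] .
  then show b: "derivs_bounded l f 1"
    using derivs_bounded_mono[OF derivs_bounded_C_norm _ order_refl, of l f K 1] assms
    by (simp add: C0_unit_ball_def)
  show "\<bar>f x\<bar> \<le> 1" by (rule derivs_bounded_abs[OF b])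
  show "continuous_on UNIV f" by (rule C_space_continuous[OF C0_space_C_space[OF f]])
  show "(f \<longlongrightarrow> 0) at_infinity" by (rule C0_space_tendsto[OF f])
qed

text \<open>Turns an arbitrary function of \<open>C0_space\<close> into an admissible test function,
  so that the metric controls its integrals up to a factor.\<close>

lemma scaled_in_C0_unit_ball:
  fixes f :: "real^'n::finite \<Rightarrow> real"
  assumes "f \<in> C0_space l" "derivs_bounded l f K" "0 < K"
  shows "(\<lambda>x. 1 / (num_derivs TYPE('n) l * K) * f x) \<in> C0_unit_ball l"
proof -
  let ?a = "num_derivs TYPE('n) l * K"
  have a: "0 < ?a" using assms(3) num_derivs_pos[where 'n = 'n] by simp
  have "C_norm l (\<lambda>x. 1 / ?a * f x) \<le> \<bar>1 / ?a\<bar> * C_norm l f"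
    by (rule C_norm_cmult_le[OF C0_space_C_space[OF assms(1)] assms(2)])
  also have "\<dots> \<le> \<bar>1 / ?a\<bar> * ?a" by (intro mult_left_mono C_norm_le[OF assms(2)]) simp
  also have "\<dots> = 1" using assms(3) num_derivs_pos[where 'n = 'n, of l] by (simp add: abs_mult)
  finally show ?thesis using C0_space_cmult[OF assms(1), of "1 / ?a"] by (simp add: C0_unit_ball_def)
qed

lemma C0_unit_ball_nonempty: "(C0_unit_ball l :: (real^'n::finite \<Rightarrow> real) set) \<noteq> {}"
proof -
  obtain K where "0 < K" "derivs_bounded l (cutoff l :: real^'n \<Rightarrow> real) K" using cutoff_derivs_bounded .
  then have "(\<lambda>x::real^'n. 1 / (num_derivs TYPE('n) l * K) * cutoff l x) \<in> C0_unit_ball l"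
    by (intro scaled_in_C0_unit_ball subsetD[OF Cc_space_subset_C0_space cutoff_Cc_space])
  then show ?thesis by blast
qed

text \<open>Each partial derivative is at most 1 and each component of \<open>h\<close> at most
  \<open>norm h\<close>, so the differential has operator norm at most the dimension; the mean value
  inequality on the convex whole space concludes.\<close>

lemma C0_unit_ball_lipschitz:
  fixes f :: "real^'n::finite \<Rightarrow> real"
  assumes "f \<in> C0_unit_ball l" "1 \<le> l"
  shows "\<bar>f x - f y\<bar> \<le> real CARD('n) * dist x y"
proof -
  have "f \<in> C_space (Suc 0)"
    using C_space_mono[OF C0_space_C_space[OF C0_unit_ballD(1)[OF assms(1)]]] assms(2) by simp
  then have diff: "(f has_derivative frechet_derivative f (at x)) (at x)" for x
    by (simp add: C_space_Suc frechet_derivative_works)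
  have b: "derivs_bounded (Suc 0) f 1"
    using derivs_bounded_mono[OF C0_unit_ballD(2)[OF assms(1)] order_refl] assms(2) by simp
  have on: "onorm (frechet_derivative f (at x)) \<le> real CARD('n)" for x
  proof (rule onorm_le)
    fix h
    let ?D = "frechet_derivative f (at x)"
    have lin: "linear ?D" by (rule has_derivative_linear[OF diff])
    have "?D h = ?D (\<Sum>i\<in>UNIV. h $ i *\<^sub>R axis i 1)" by (simp add: basis_expansion flip: scalar_mult_eq_scaleR)
    also have "\<dots> = (\<Sum>i\<in>UNIV. h $ i * partial_deriv i f x)"
      by (simp add: linear_sum[OF lin] linear_scale[OF lin] partial_deriv_def)
    also have "norm \<dots> \<le> (\<Sum>i\<in>(UNIV::'n set). norm h)"
    proof (rule order_trans[OF norm_sum sum_mono])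
      fix i
      have "\<bar>partial_deriv i f x\<bar> \<le> 1" using b by (auto simp: derivs_bounded_Suc derivs_bounded_0)
      then have "\<bar>h $ i\<bar> * \<bar>partial_deriv i f x\<bar> \<le> norm h * 1"
        by (intro mult_mono component_le_norm_cart) auto
      then show "norm (h $ i * partial_deriv i f x) \<le> norm h" by (simp add: abs_mult)
    qed
    finally show "norm (?D h) \<le> real CARD('n) * norm h" by simp
  qed
  have "norm (f x - f y) \<le> real CARD('n) * norm (x - y)"
    by (rule differentiable_bound[OF convex_UNIV diff on]) auto
  then show ?thesis by (simp add: dist_norm)
qed

section \<open>The metric\<close>

abbreviation mass :: "(real^'n::finite) measure \<Rightarrow> real" where
  "mass \<mu> \<equiv> measure \<mu> UNIV"

lemma integral_const_finite_borel:
  assumes "\<mu> \<in> finite_borel_measures"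
  shows "(\<integral>x. c \<partial>\<mu>) = c * mass \<mu>"
  using finite_borel_measuresD[OF assms] by simp

lemma abs_integral_le:
  fixes f g :: "real^'n::finite \<Rightarrow> real"
  assumes "\<mu> \<in> finite_borel_measures" "integrable \<mu> f" "integrable \<mu> g" "\<And>x. \<bar>f x\<bar> \<le> g x"
  shows "\<bar>integral\<^sup>L \<mu> f\<bar> \<le> integral\<^sup>L \<mu> g"
proof -
  have "\<bar>integral\<^sup>L \<mu> f\<bar> \<le> (\<integral>x. \<bar>f x\<bar> \<partial>\<mu>)" by (rule integral_abs_bound)
  also have "\<dots> \<le> integral\<^sup>L \<mu> g" using assms by (intro integral_mono) auto
  finally show ?thesis .
qed

text \<open>The supremum defining the metric is over a bounded set because the test functions are
  bounded by 1.\<close>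

lemma integral_gap_le_mass:
  fixes f :: "real^'n::finite \<Rightarrow> real"
  assumes "\<mu> \<in> finite_borel_measures" "\<nu> \<in> finite_borel_measures" "f \<in> C0_unit_ball l"
  shows "integral_gap \<mu> \<nu> f \<le> mass \<mu> + mass \<nu>"
proof -
  have "\<bar>integral\<^sup>L \<kappa> f\<bar> \<le> mass \<kappa>" if "\<kappa> \<in> finite_borel_measures" for \<kappa>
  proof -
    interpret finite_measure \<kappa> by (rule finite_borel_measuresD[OF that])
    have "\<bar>integral\<^sup>L \<kappa> f\<bar> \<le> (\<integral>x. 1 \<partial>\<kappa>)"
      using C0_unit_ballD[OF assms(3)] by (intro abs_integral_le that integrable_bounded_continuous[where B = 1]) auto
    then show ?thesis using finite_borel_measuresD[OF that] by simp
  qed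
  from this[OF assms(1)] this[OF assms(2)] show ?thesis unfolding integral_gap_def by linarith
qed

lemma bdd_above_integral_gap:
  fixes \<mu> \<nu> :: "(real^'n::finite) measure"
  assumes "\<mu> \<in> finite_borel_measures" "\<nu> \<in> finite_borel_measures"
  shows "bdd_above (integral_gap \<mu> \<nu> ` C0_unit_ball l)"
  by (rule bdd_aboveI2) (rule integral_gap_le_mass[OF assms])

lemma integral_gap_le_D_dist:
  fixes \<mu> \<nu> :: "(real^'n::finite) measure"
  assumes "\<mu> \<in> finite_borel_measures" "\<nu> \<in> finite_borel_measures" "f \<in> C0_unit_ball l"
  shows "integral_gap \<mu> \<nu> f \<le> D_dist l \<mu> \<nu>"
  using assms(1,2) cSUP_upper[OF assms(3) bdd_above_integral_gap[OF assms(1,2)]] by (simp add: D_dist_def)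

lemma D_dist_le:
  fixes \<mu> \<nu> :: "(real^'n::finite) measure"
  assumes "\<mu> \<in> finite_borel_measures" "\<nu> \<in> finite_borel_measures"
    "\<And>f. f \<in> C0_unit_ball l \<Longrightarrow> integral_gap \<mu> \<nu> f \<le> a"
  shows "D_dist l \<mu> \<nu> \<le> a"
  using assms(1,2) cSUP_least[OF C0_unit_ball_nonempty assms(3)] by (simp add: D_dist_def)

lemma integral_gap_nonneg: "0 \<le> integral_gap \<mu> \<nu> f"
  by (simp add: integral_gap_def)

lemma D_dist_nonneg: "0 \<le> D_dist l \<mu> (\<nu> :: (real^'n::finite) measure)"
proof (cases "\<mu> \<in> finite_borel_measures \<and> \<nu> \<in> finite_borel_measures")
  case True
  obtain f :: "real^'n \<Rightarrow> real" where f: "f \<in> C0_unit_ball l" using C0_unit_ball_nonempty by blast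
  have "integral_gap \<mu> \<nu> f \<le> D_dist l \<mu> \<nu>" using True f by (intro integral_gap_le_D_dist) auto
  then show ?thesis using integral_gap_nonneg[of \<mu> \<nu> f] by linarith
qed (auto simp: D_dist_def)

lemma D_dist_commute: "D_dist l \<mu> \<nu> = D_dist l \<nu> \<mu>"
  by (auto simp: D_dist_def integral_gap_def abs_minus_commute)

lemma D_dist_triangle:
  fixes \<mu> \<nu> \<kappa> :: "(real^'n::finite) measure"
  assumes "\<mu> \<in> finite_borel_measures" "\<nu> \<in> finite_borel_measures" "\<kappa> \<in> finite_borel_measures"
  shows "D_dist l \<mu> \<kappa> \<le> D_dist l \<mu> \<nu> + D_dist l \<nu> \<kappa>"
proof (rule D_dist_le[OF assms(1,3)])
  fix f :: "real^'n \<Rightarrow> real" assume f: "f \<in> C0_unit_ball l"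
  have "integral_gap \<mu> \<kappa> f \<le> integral_gap \<mu> \<nu> f + integral_gap \<nu> \<kappa> f" by (simp add: integral_gap_def)
  also have "\<dots> \<le> D_dist l \<mu> \<nu> + D_dist l \<nu> \<kappa>"
    by (intro add_mono integral_gap_le_D_dist assms f)
  finally show "integral_gap \<mu> \<kappa> f \<le> D_dist l \<mu> \<nu> + D_dist l \<nu> \<kappa>" .
qed

lemma integral_gap_le_C0:
  fixes f :: "real^'n::finite \<Rightarrow> real"
  assumes "\<mu> \<in> finite_borel_measures" "\<nu> \<in> finite_borel_measures"
    "f \<in> C0_space l" "derivs_bounded l f K" "0 < K"
  shows "integral_gap \<mu> \<nu> f \<le> num_derivs TYPE('n) l * K * D_dist l \<mu> \<nu>"
proof -
  let ?a = "num_derivs TYPE('n) l * K"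
  have a: "0 < ?a" using assms(5) num_derivs_pos[where 'n = 'n] by simp
  have "integral_gap \<mu> \<nu> (\<lambda>x. 1 / ?a * f x) \<le> D_dist l \<mu> \<nu>"
    by (rule integral_gap_le_D_dist[OF assms(1,2) scaled_in_C0_unit_ball[OF assms(3-5)]])
  moreover have "integral_gap \<mu> \<nu> (\<lambda>x. 1 / ?a * f x) = 1 / ?a * integral_gap \<mu> \<nu> f"
    using a unfolding integral_gap_def integral_mult_right_zero right_diff_distrib[symmetric] abs_mult
    by (simp only: abs_of_pos divide_pos_pos zero_less_one)
  ultimately show ?thesis using a by (simp add: field_simps)
qed

section \<open>Convergence of the metric and narrow convergence\<close>

lemma cutoff_integral_tendsto_mass:
  fixes \<mu> :: "(real^'n::finite) measure"
  assumes "\<mu> \<in> finite_borel_measures"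
  shows "(\<lambda>j. \<integral>x. cutoff l (inverse (real (Suc j)) *\<^sub>R x) \<partial>\<mu>) \<longlonglongrightarrow> mass \<mu>"
proof -
  interpret finite_measure \<mu> by (rule finite_borel_measuresD[OF assms])
  have c: "continuous_on UNIV (\<lambda>x::real^'n. cutoff l (c *\<^sub>R x))" for c
    by (rule C_space_continuous[OF C_space_scale[OF cutoff_C_space]])
  have m: "(\<lambda>x. cutoff l (c *\<^sub>R x)) \<in> borel_measurable \<mu>" for c
    using borel_measurable_continuous_onI[OF c] finite_borel_measuresD(2)[OF assms]
    by (simp cong: measurable_cong_sets)
  have inv: "filterlim (\<lambda>j. inverse (real (Suc j))) (at_right 0) sequentially"
    using LIMSEQ_inverse_real_of_nat by (simp add: filterlim_at)
  have "(\<lambda>j. \<integral>x. cutoff l (inverse (real (Suc j)) *\<^sub>R x) \<partial>\<mu>) \<longlonglongrightarrow> (\<integral>x. 1 \<partial>\<mu>)"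
    by (rule integral_dominated_convergence[where w = "\<lambda>_. 1"])
      (simp_all add: m filterlim_compose[OF cutoff_tendsto_1 inv] del: of_nat_Suc)
  then show ?thesis using finite_borel_measuresD[OF assms] by simp
qed

text \<open>The constant 1 is not a test function, but the bound for the rescaled cutoffs does not
  depend on the scale and survives the limit in which they increase to 1.\<close>

lemma mass_difference_le_D_dist:
  obtains C where "0 < C" "\<forall>\<mu> \<in> finite_borel_measures. \<forall>\<nu> \<in> finite_borel_measures.
    \<bar>mass \<mu> - mass (\<nu> :: (real^'n::finite) measure)\<bar> \<le> C * D_dist l \<mu> \<nu>"
proof -
  obtain K where K: "0 < K" "derivs_bounded l (cutoff l :: real^'n \<Rightarrow> real) K" using cutoff_derivs_bounded .
  let ?C = "num_derivs TYPE('n) l * K"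
  have "\<bar>mass \<mu> - mass \<nu>\<bar> \<le> ?C * D_dist l \<mu> \<nu>"
    if \<mu>: "\<mu> \<in> finite_borel_measures" and \<nu>: "\<nu> \<in> finite_borel_measures" for \<mu> \<nu> :: "(real^'n) measure"
  proof (rule LIMSEQ_le_const2)
    show "(\<lambda>j. integral_gap \<mu> \<nu> (\<lambda>x. cutoff l (inverse (real (Suc j)) *\<^sub>R x))) \<longlonglongrightarrow> \<bar>mass \<mu> - mass \<nu>\<bar>"
      unfolding integral_gap_def by (intro tendsto_intros cutoff_integral_tendsto_mass \<mu> \<nu>)
    have "integral_gap \<mu> \<nu> (\<lambda>x. cutoff l (inverse (real (Suc j)) *\<^sub>R x)) \<le> ?C * D_dist l \<mu> \<nu>" for j
    proof (rule integral_gap_le_C0[OF \<mu> \<nu> _ _ K(1)])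
      show "(\<lambda>x::real^'n. cutoff l (inverse (real (Suc j)) *\<^sub>R x)) \<in> C0_space l"
        using cutoff_scale_mult_Cc_space[OF C_space_const[of 1], of "inverse (real (Suc j))" l]
        by (intro subsetD[OF Cc_space_subset_C0_space]) simp
      show "derivs_bounded l (\<lambda>x::real^'n. cutoff l (inverse (real (Suc j)) *\<^sub>R x)) K"
        by (rule cutoff_scale_bounded[OF K(2)]) (auto simp: inverse_le_1_iff)
    qed
    then show "\<exists>N. \<forall>n\<ge>N. integral_gap \<mu> \<nu> (\<lambda>x. cutoff l (inverse (real (Suc n)) *\<^sub>R x)) \<le> ?C * D_dist l \<mu> \<nu>"
      by blast
  qed
  moreover have "0 < ?C" using K num_derivs_pos[where 'n = 'n] by simp
  ultimately show ?thesis using that by blast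
qed

text \<open>The approximation error is measured by a majorant \<open>h\<close> whose integrals
  converge too; its smallness under \<open>\<mu>\<close> therefore passes to \<open>X i\<close>
  eventually. No sequential argument enters, so any filter is allowed.\<close>

lemma tendsto_integral_by_approximation:
  fixes f :: "real^'n::finite \<Rightarrow> real"
  assumes X: "\<And>i. X i \<in> finite_borel_measures" and \<mu>: "\<mu> \<in> finite_borel_measures"
    and f: "\<And>\<nu>. \<nu> \<in> finite_borel_measures \<Longrightarrow> integrable \<nu> f"
    and approx: "\<And>e. 0 < e \<Longrightarrow> \<exists>g h. (\<forall>\<nu>\<in>finite_borel_measures. integrable \<nu> g \<and> integrable \<nu> h) \<and>
      (\<forall>x. \<bar>f x - g x\<bar> \<le> h x) \<and> ((\<lambda>i. integral\<^sup>L (X i) g) \<longlongrightarrow> integral\<^sup>L \<mu> g) F \<and>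
      ((\<lambda>i. integral\<^sup>L (X i) h) \<longlongrightarrow> integral\<^sup>L \<mu> h) F \<and> integral\<^sup>L \<mu> h < e"
  shows "((\<lambda>i. integral\<^sup>L (X i) f) \<longlongrightarrow> integral\<^sup>L \<mu> f) F"
  unfolding tendsto_iff
proof (intro allI impI)
  fix e :: real assume "0 < e"
  then obtain g h where gh: "\<And>\<nu>. \<nu> \<in> finite_borel_measures \<Longrightarrow> integrable \<nu> g"
    "\<And>\<nu>. \<nu> \<in> finite_borel_measures \<Longrightarrow> integrable \<nu> h" "\<And>x. \<bar>f x - g x\<bar> \<le> h x"
    and lim: "((\<lambda>i. integral\<^sup>L (X i) g) \<longlongrightarrow> integral\<^sup>L \<mu> g) F" "((\<lambda>i. integral\<^sup>L (X i) h) \<longlongrightarrow> integral\<^sup>L \<mu> h) F"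
    and e: "integral\<^sup>L \<mu> h < e / 3"
    using approx[of "e / 3"] by auto
  have le: "\<bar>integral\<^sup>L \<nu> f - integral\<^sup>L \<nu> g\<bar> \<le> integral\<^sup>L \<nu> h" if "\<nu> \<in> finite_borel_measures" for \<nu>
    using abs_integral_le[OF that _ gh(2)[OF that] gh(3)] f[OF that] gh(1)[OF that] by simp
  have "\<forall>\<^sub>F i in F. dist (integral\<^sup>L (X i) g) (integral\<^sup>L \<mu> g) < e / 3"
    using lim(1) \<open>0 < e\<close> by (intro tendstoD) auto
  moreover have "\<forall>\<^sub>F i in F. integral\<^sup>L (X i) h < e / 3" using lim(2) e by (rule order_tendstoD(2))
  ultimately show "\<forall>\<^sub>F i in F. dist (integral\<^sup>L (X i) f) (integral\<^sup>L \<mu> f) < e"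
  proof eventually_elim
    case (elim i)
    then show ?case using le[OF X[of i]] le[OF \<mu>] e unfolding dist_real_def by linarith
  qed
qed

text \<open>Convergence of masses controls the tails: the integral of \<open>1 - \<phi>\<close>
  under \<open>X i\<close> is a mass minus the integral of a compactly supported function, so it
  converges.\<close>

lemma narrow_limit_if_Cc_and_mass:
  fixes \<mu> :: "(real^'n::finite) measure"
  assumes X: "\<And>i. X i \<in> finite_borel_measures" and \<mu>: "\<mu> \<in> finite_borel_measures"
    and Cc: "\<And>f. f \<in> Cc_space l \<Longrightarrow> ((\<lambda>i. integral\<^sup>L (X i) f) \<longlongrightarrow> integral\<^sup>L \<mu> f) F"
    and mass: "((\<lambda>i. mass (X i)) \<longlongrightarrow> mass \<mu>) F"
  shows "narrow_limit X \<mu> F"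
  unfolding narrow_limit_def
proof (intro allI impI, elim conjE)
  fix f :: "real^'n \<Rightarrow> real" assume f: "continuous_on UNIV f" "bounded (range f)"
  obtain B where B: "0 < B" "\<And>x. \<bar>f x\<bar> \<le> B" using f(2) by (auto simp: bounded_pos)
  show "((\<lambda>i. integral\<^sup>L (X i) f) \<longlongrightarrow> integral\<^sup>L \<mu> f) F"
  proof (rule tendsto_integral_by_approximation[OF X \<mu>])
    show "integrable \<nu> f" if "\<nu> \<in> finite_borel_measures" for \<nu>
      by (rule integrable_bounded_continuous[OF that f(1) B(2)])
    fix e :: real assume e: "0 < e"
    define d where "d = e / (2 * (1 + mass \<mu>))"
    have M: "0 < 1 + mass \<mu>" by (simp add: add_pos_nonneg)
    then have d: "0 < d" "d * mass \<mu> < e / 2" using e by (auto simp: d_def field_simps)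
    have "(\<lambda>j. B * (mass \<mu> - (\<integral>x. cutoff l (inverse (real (Suc j)) *\<^sub>R x) \<partial>\<mu>))) \<longlonglongrightarrow> B * (mass \<mu> - mass \<mu>)"
      by (intro tendsto_intros cutoff_integral_tendsto_mass \<mu>)
    then have "\<forall>\<^sub>F j in sequentially. B * (mass \<mu> - (\<integral>x. cutoff l (inverse (real (Suc j)) *\<^sub>R x) \<partial>\<mu>)) < e / 2"
      by (rule order_tendstoD(2)) (use e in simp)
    then obtain j where j: "B * (mass \<mu> - (\<integral>x. cutoff l (inverse (real (Suc j)) *\<^sub>R x) \<partial>\<mu>)) < e / 2"
      using eventually_happens'[OF sequentially_bot] by blast
    define \<phi> where "\<phi> = (\<lambda>x::real^'n. cutoff l (inverse (real (Suc j)) *\<^sub>R x))"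
    have \<phi>C: "\<phi> \<in> Cc_space l"
      using cutoff_scale_mult_Cc_space[OF C_space_const[of 1], of "inverse (real (Suc j))" l] by (simp add: \<phi>_def)
    have \<phi>: "0 \<le> \<phi> x" "\<phi> x \<le> 1" "norm x \<ge> real (Suc j) \<Longrightarrow> \<phi> x = 0" for x
    proof -
      show "norm x \<ge> real (Suc j) \<Longrightarrow> \<phi> x = 0"
        unfolding \<phi>_def by (rule cutoff_eq_0) (simp add: field_simps)
    qed (simp_all add: \<phi>_def)
    have \<phi>c: "continuous_on UNIV \<phi>" using \<phi>C C_space_continuous by (auto simp: Cc_space_def)
    obtain p where p: "real_polynomial_function p" "\<And>x. x \<in> cball 0 (real (Suc j)) \<Longrightarrow> \<bar>f x - p x\<bar> < d"
      using Stone_Weierstrass_real_polynomial_function[OF compact_cball continuous_on_subset[OF f(1) subset_UNIV] d(1)]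
      by blast
    define g where "g = (\<lambda>x. \<phi> x * p x)"
    \<comment> \<open>The polynomial is accurate to \<open>d\<close> where \<open>\<phi>\<close> is
      nonzero, and the discarded part \<open>(1 - \<phi>) * f\<close> is at most
      \<open>B * (1 - \<phi>)\<close>.\<close>
    define h where "h = (\<lambda>x. B * (1 - \<phi> x) + d)"
    have gC: "g \<in> Cc_space l"
      unfolding g_def \<phi>_def by (rule cutoff_scale_mult_Cc_space[OF C_space_real_polynomial[OF p(1)]]) simp
    have int: "integrable \<nu> u" if "\<nu> \<in> finite_borel_measures" "u \<in> Cc_space l" for \<nu> and u :: "real^'n \<Rightarrow> real"
    proof -
      have u: "u \<in> C0_space l" using that(2) Cc_space_subset_C0_space by blast
      obtain K where "derivs_bounded l u K" using C0_space_bounded[OF u] .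
      then show ?thesis
        by (intro integrable_bounded_continuous[OF that(1) C_space_continuous[OF C0_space_C_space[OF u]]] derivs_bounded_abs)
    qed
    have inth: "integral\<^sup>L \<nu> h = B * (mass \<nu> - integral\<^sup>L \<nu> \<phi>) + d * mass \<nu>" "integrable \<nu> h"
      if "\<nu> \<in> finite_borel_measures" for \<nu>
    proof -
      interpret finite_measure \<nu> by (rule finite_borel_measuresD[OF that])
      show "integrable \<nu> h" unfolding h_def using int[OF that \<phi>C] by simp
      show "integral\<^sup>L \<nu> h = B * (mass \<nu> - integral\<^sup>L \<nu> \<phi>) + d * mass \<nu>"
        unfolding h_def using int[OF that \<phi>C] finite_borel_measuresD(3)[OF that] by simp
    qed
    have "\<bar>f x - g x\<bar> \<le> h x" for x
    proof -
      have "\<phi> x * \<bar>f x - p x\<bar> \<le> d"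
      proof (cases "norm x \<le> real (Suc j)")
        case True
        then have "\<phi> x * \<bar>f x - p x\<bar> \<le> 1 * d" using p(2)[of x] \<phi>[of x] by (intro mult_mono) auto
        then show ?thesis by simp
      qed (use \<phi>(3)[of x] d in auto)
      moreover have "(1 - \<phi> x) * \<bar>f x\<bar> \<le> (1 - \<phi> x) * B" using \<phi>[of x] B by (intro mult_left_mono) auto
      moreover have "f x - g x = (1 - \<phi> x) * f x + \<phi> x * (f x - p x)" by (simp add: g_def algebra_simps)
      then have "\<bar>f x - g x\<bar> \<le> (1 - \<phi> x) * \<bar>f x\<bar> + \<phi> x * \<bar>f x - p x\<bar>"
        using abs_triangle_ineq[of "(1 - \<phi> x) * f x" "\<phi> x * (f x - p x)"] \<phi>[of x] by (simp add: abs_mult)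
      ultimately show ?thesis by (simp add: h_def mult.commute)
    qed
    moreover have "((\<lambda>i. integral\<^sup>L (X i) h) \<longlongrightarrow> integral\<^sup>L \<mu> h) F"
      unfolding inth(1)[OF X] inth(1)[OF \<mu>] by (intro tendsto_intros mass Cc \<phi>C)
    moreover have "integral\<^sup>L \<mu> h < e" using j d(2) unfolding inth(1)[OF \<mu>] \<phi>_def by linarith
    ultimately show "\<exists>g h. (\<forall>\<nu>\<in>finite_borel_measures. integrable \<nu> g \<and> integrable \<nu> h) \<and>
      (\<forall>x. \<bar>f x - g x\<bar> \<le> h x) \<and> ((\<lambda>i. integral\<^sup>L (X i) g) \<longlongrightarrow> integral\<^sup>L \<mu> g) F \<and>
      ((\<lambda>i. integral\<^sup>L (X i) h) \<longlongrightarrow> integral\<^sup>L \<mu> h) F \<and> integral\<^sup>L \<mu> h < e"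
      using int[OF _ gC] inth(2) Cc[OF gC] by (intro exI[of _ g] exI[of _ h]) auto
  qed
qed

lemma narrow_limit_if_D_dist_tendsto:
  fixes \<mu> :: "(real^'n::finite) measure"
  assumes X: "\<And>i. X i \<in> finite_borel_measures" and \<mu>: "\<mu> \<in> finite_borel_measures"
    and D: "((\<lambda>i. D_dist l (X i) \<mu>) \<longlongrightarrow> 0) F"
  shows "narrow_limit X \<mu> F"
proof (rule narrow_limit_if_Cc_and_mass[where l = l, OF X \<mu>])
  have DC: "((\<lambda>i. c * D_dist l (X i) \<mu>) \<longlongrightarrow> 0) F" for c using tendsto_mult_right_zero[OF D] .
  obtain C where C: "\<forall>\<mu> \<in> finite_borel_measures. \<forall>\<nu> \<in> finite_borel_measures.
    \<bar>mass \<mu> - mass (\<nu> :: (real^'n::finite) measure)\<bar> \<le> C * D_dist l \<mu> \<nu>"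
    using mass_difference_le_D_dist .
  have "((\<lambda>i. mass (X i) - mass \<mu>) \<longlongrightarrow> 0) F"
    by (rule Lim_null_comparison[OF _ DC[of C]]) (use C X \<mu> in auto)
  then show "((\<lambda>i. mass (X i)) \<longlongrightarrow> mass \<mu>) F" by (simp add: LIM_zero_iff)
  fix f :: "real^'n \<Rightarrow> real" assume "f \<in> Cc_space l"
  then have f: "f \<in> C0_space l" using Cc_space_subset_C0_space by blast
  obtain K where K: "0 < K" "derivs_bounded l f K" using C0_space_bounded[OF f] .
  have "((\<lambda>i. integral\<^sup>L (X i) f - integral\<^sup>L \<mu> f) \<longlongrightarrow> 0) F"
    by (rule Lim_null_comparison[OF _ DC[of "num_derivs TYPE('n) l * K"]])
      (use integral_gap_le_C0[OF X \<mu> f K(2,1)] in \<open>auto simp: integral_gap_def\<close>)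
  then show "((\<lambda>i. integral\<^sup>L (X i) f) \<longlongrightarrow> integral\<^sup>L \<mu> f) F" by (simp add: LIM_zero_iff)
qed

lemma narrow_limitD:
  fixes f :: "real^'n::finite \<Rightarrow> real"
  assumes "narrow_limit X \<mu> F" "continuous_on UNIV f" "\<And>x. \<bar>f x\<bar> \<le> B"
  shows "((\<lambda>i. integral\<^sup>L (X i) f) \<longlongrightarrow> integral\<^sup>L \<mu> f) F"
proof -
  have "bounded (range f)" using assms(3) by (auto simp: bounded_iff)
  then show ?thesis using assms(1,2) by (simp add: narrow_limit_def)
qed

section \<open>From narrow convergence to convergence in the metric\<close>

lemma tight_ball:
  fixes \<mu> :: "(real^'n::finite) measure"
  assumes \<mu>: "\<mu> \<in> finite_borel_measures" and "0 < e"
  obtains b where "measure \<mu> (- cball 0 b) < e"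
proof -
  interpret finite_measure \<mu> by (rule finite_borel_measuresD[OF \<mu>])
  have se: "sets \<mu> = sets borel" and sp: "space \<mu> = UNIV" using finite_borel_measuresD[OF \<mu>] by auto
  have "(\<lambda>j. measure \<mu> (cball 0 (real j))) \<longlonglongrightarrow> measure \<mu> (\<Union>j. cball 0 (real j))"
    by (rule finite_Lim_measure_incseq) (auto simp: incseq_def se)
  moreover have "(\<Union>j. cball 0 (real j)) = (UNIV :: (real^'n) set)"
    using real_arch_simple by auto
  ultimately have "(\<lambda>j. measure \<mu> (cball 0 (real j))) \<longlonglongrightarrow> mass \<mu>" by simp
  then have "\<forall>\<^sub>F j in sequentially. mass \<mu> - e < measure \<mu> (cball 0 (real j))"
    by (rule order_tendstoD(1)) (use assms(2) in simp)
  then obtain j where "mass \<mu> - e < measure \<mu> (cball 0 (real j))"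
    using eventually_happens'[OF sequentially_bot] by blast
  moreover have "measure \<mu> (- cball 0 (real j)) = mass \<mu> - measure \<mu> (cball 0 (real j))"
    using finite_measure_compl[of "cball 0 (real j)"] by (simp add: se sp Compl_eq_Diff_UNIV)
  ultimately show ?thesis using that[of "real j"] by simp
qed

text \<open>The test functions are uniformly Lipschitz, so a single partition of unity on a large ball
  approximates all of them at once.\<close>

lemma D_dist_tendsto_if_narrow_limit:
  fixes \<mu> :: "(real^'n::finite) measure"
  assumes X: "\<And>i. X i \<in> finite_borel_measures" and \<mu>: "\<mu> \<in> finite_borel_measures"
    and lim: "narrow_limit X \<mu> F" and l: "1 \<le> l"
  shows "((\<lambda>i. D_dist l (X i) \<mu>) \<longlongrightarrow> 0) F"
  unfolding tendsto_iff
proof (intro allI impI)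
  fix e :: real assume e: "0 < e"
  define N where "N = real CARD('n)"
  have N: "0 < N" by (simp add: N_def)
  \<comment> \<open>The bound \<open>R\<close> below tends to twice \<open>E \<mu>\<close>, to which
    the Lipschitz error contributes \<open>4 * \<delta> * N * mass \<mu>\<close>; this choice keeps
    it under \<open>e / 2\<close>, also for mass 0.\<close>
  define \<delta> where "\<delta> = e / (8 * N * (1 + mass \<mu>))"
  have M: "0 < 1 + mass \<mu>" by (simp add: add_pos_nonneg)
  have "4 * \<delta> * N * mass \<mu> = e / 2 * (mass \<mu> / (1 + mass \<mu>))" using N M by (simp add: \<delta>_def)
  also have "\<dots> < e / 2 * 1" using e M by (intro mult_strict_left_mono) auto
  finally have \<delta>: "0 < \<delta>" "4 * \<delta> * N * mass \<mu> < e / 2" using e N M by (simp_all add: \<delta>_def)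
  obtain b where b: "measure \<mu> (- cball 0 b) < e / 4" using tight_ball[OF \<mu>, of "e / 4"] e by auto
  obtain C where C: "finite C" "cball (0::real^'n) b \<subseteq> (\<Union>c\<in>C. ball c \<delta>)"
    using conjunct2[OF iffD1[OF compact_eq_totally_bounded compact_cball[of "0::real^'n" b]], rule_format, OF \<delta>(1)]
    by auto
  \<comment> \<open>Tents of radius \<open>2 * \<delta>\<close> over a cover by balls of radius
    \<open>\<delta>\<close> have a positive sum on the large ball, and \<open>h\<close> is positive
    outside it; hence the normalizing sum \<open>T\<close> never vanishes.\<close>
  define g where "g = (\<lambda>(c::real^'n) (x::real^'n). max 0 (2 * \<delta> - dist c x))"
  define h where "h = (\<lambda>x::real^'n. max 0 (norm x - b))"
  define T where "T = (\<lambda>x. (\<Sum>c\<in>C. g c x) + h x)"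
  define \<rho> where "\<rho> = (\<lambda>c x. g c x / T x)"
  define \<rho>0 where "\<rho>0 = (\<lambda>x. h x / T x)"
  have g0: "0 \<le> g c x" and h0: "0 \<le> h x" for c x by (auto simp: g_def h_def)
  have T: "0 < T x" for x
  proof (cases "norm x \<le> b")
    case True
    then obtain c where c: "c \<in> C" "dist c x < \<delta>" using C(2) by force
    then have "0 < g c x" using \<delta>(1) by (simp add: g_def)
    then have "0 < (\<Sum>c\<in>C. g c x)" using c g0 C(1) by (intro sum_pos2[of C c]) auto
    then show ?thesis using h0[of x] by (simp add: T_def)
  next
    case False
    then have "0 < h x" by (simp add: h_def)
    then show ?thesis using g0 by (simp add: T_def add_nonneg_pos sum_nonneg)
  qed
  have \<rho>_nonneg: "0 \<le> \<rho> c x" "0 \<le> \<rho>0 x" for c x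
    using g0 h0 T by (auto simp: \<rho>_def \<rho>0_def less_imp_le)
  have sum1: "(\<Sum>c\<in>C. \<rho> c x) + \<rho>0 x = 1" for x
    using T[of x] unfolding \<rho>_def \<rho>0_def sum_divide_distrib[symmetric] add_divide_distrib[symmetric]
    by (simp add: T_def)
  have \<rho>0_le: "\<rho>0 x \<le> 1" for x using sum1[of x] sum_nonneg[of C "\<lambda>c. \<rho> c x"] \<rho>_nonneg by simp
  have \<rho>_le: "\<rho> c x \<le> 1" if "c \<in> C" for c x
    using sum1[of x] member_le_sum[OF that, of "\<lambda>c. \<rho> c x"] C(1) \<rho>_nonneg(1)[of _ x] \<rho>_nonneg(2)[of x] by auto
  have Tc: "continuous_on UNIV T" unfolding T_def g_def h_def by (intro continuous_intros)
  have \<rho>c: "continuous_on UNIV (\<rho> c)" "continuous_on UNIV \<rho>0" for c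
  proof -
    show "continuous_on UNIV (\<rho> c)"
      unfolding \<rho>_def using T by (intro continuous_on_divide Tc) (auto simp: g_def less_imp_neq[symmetric] intro!: continuous_intros)
    show "continuous_on UNIV \<rho>0"
      unfolding \<rho>0_def using T by (intro continuous_on_divide Tc) (auto simp: h_def less_imp_neq[symmetric] intro!: continuous_intros)
  qed
  have int: "integrable \<nu> (\<rho> c)" "integrable \<nu> \<rho>0" if "\<nu> \<in> finite_borel_measures" "c \<in> C" for \<nu> c
    using \<rho>_nonneg \<rho>_le[OF that(2)] \<rho>0_le by (auto intro!: integrable_bounded_continuous[OF that(1), where B = 1] \<rho>c)
  have int0: "integrable \<nu> \<rho>0" if "\<nu> \<in> finite_borel_measures" for \<nu>
    using \<rho>_nonneg \<rho>0_le by (auto intro!: integrable_bounded_continuous[OF that(1), where B = 1] \<rho>c)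
  \<comment> \<open>\<open>E \<nu>\<close> bounds the error of replacing \<open>f\<close> by the
    combination of the \<open>\<rho> c\<close> with coefficients \<open>f c\<close>: a Lipschitz
    error over distance \<open>2 * \<delta>\<close>, and at most \<open>\<rho>0\<close> from the
    remaining weight. Neither it nor \<open>R\<close> depends on \<open>f\<close>.\<close>
  define E where "E = (\<lambda>\<nu>. 2 * \<delta> * N * mass \<nu> + integral\<^sup>L \<nu> \<rho>0)"
  define R where "R = (\<lambda>i. E (X i) + E \<mu> + (\<Sum>c\<in>C. \<bar>integral\<^sup>L (X i) (\<rho> c) - integral\<^sup>L \<mu> (\<rho> c)\<bar>))"
  have "integral_gap (X i) \<mu> f \<le> R i" if f: "f \<in> C0_unit_ball l" for f i
  proof -
    let ?s = "\<lambda>x. \<Sum>c\<in>C. f c * \<rho> c x"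
    have pw: "\<bar>f x - ?s x\<bar> \<le> 2 * \<delta> * N + \<rho>0 x" for x
    proof -
      have "f x * 1 - ?s x = (\<Sum>c\<in>C. (f x - f c) * \<rho> c x) + f x * \<rho>0 x"
        unfolding sum1[of x, symmetric] by (simp add: algebra_simps sum_distrib_left sum_subtractf)
      then have "\<bar>f x - ?s x\<bar> \<le> (\<Sum>c\<in>C. \<bar>(f x - f c) * \<rho> c x\<bar>) + \<bar>f x * \<rho>0 x\<bar>"
        using order_trans[OF abs_triangle_ineq add_right_mono[OF sum_abs]] by simp
      also have "\<dots> \<le> (\<Sum>c\<in>C. 2 * \<delta> * N * \<rho> c x) + 1 * \<rho>0 x"
      proof (intro add_mono sum_mono)
        show "\<bar>f x * \<rho>0 x\<bar> \<le> 1 * \<rho>0 x"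
          unfolding abs_mult using C0_unit_ballD(3)[OF f, of x] \<rho>_nonneg by (intro mult_mono) auto
        fix c
        show "\<bar>(f x - f c) * \<rho> c x\<bar> \<le> 2 * \<delta> * N * \<rho> c x"
        proof (cases "dist c x < 2 * \<delta>")
          case True
          have "\<bar>f x - f c\<bar> \<le> N * dist x c" unfolding N_def by (rule C0_unit_ball_lipschitz[OF f l])
          also have "\<dots> \<le> N * (2 * \<delta>)" using True N by (intro mult_left_mono) (auto simp: dist_commute)
          finally have "\<bar>f x - f c\<bar> * \<rho> c x \<le> N * (2 * \<delta>) * \<rho> c x"
            using \<rho>_nonneg(1)[of c x] by (rule mult_right_mono)
          then show ?thesis using \<rho>_nonneg(1)[of c x] by (simp add: abs_mult mult.commute mult.left_commute)
        next
          case False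
          then have "\<rho> c x = 0" by (simp add: \<rho>_def g_def)
          then show ?thesis by simp
        qed
      qed
      also have "(\<Sum>c\<in>C. 2 * \<delta> * N * \<rho> c x) = 2 * \<delta> * N * (1 - \<rho>0 x)"
        using sum1[of x] by (simp add: sum_distrib_left[symmetric])
      also have "\<dots> \<le> 2 * \<delta> * N * 1" using \<delta>(1) N \<rho>_nonneg(2)[of x] by (intro mult_left_mono) auto
      finally show ?thesis by simp
    qed
    have appr: "\<bar>integral\<^sup>L \<nu> f - (\<Sum>c\<in>C. f c * integral\<^sup>L \<nu> (\<rho> c))\<bar> \<le> E \<nu>" if \<nu>: "\<nu> \<in> finite_borel_measures" for \<nu>
    proof -
      interpret finite_measure \<nu> by (rule finite_borel_measuresD[OF \<nu>])
      have fi: "integrable \<nu> f" by (rule integrable_bounded_continuous[OF \<nu> C0_unit_ballD(4,3)[OF f]])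
      have si: "integrable \<nu> ?s" using int(1)[OF \<nu>] by (intro Bochner_Integration.integrable_sum) auto
      have "\<bar>\<integral>x. f x - ?s x \<partial>\<nu>\<bar> \<le> (\<integral>x. 2 * \<delta> * N + \<rho>0 x \<partial>\<nu>)"
        using pw by (intro abs_integral_le[OF \<nu>] Bochner_Integration.integrable_diff Bochner_Integration.integrable_add fi si int0[OF \<nu>]) auto
      also have "(\<integral>x. 2 * \<delta> * N + \<rho>0 x \<partial>\<nu>) = E \<nu>"
        using int0[OF \<nu>] finite_borel_measuresD(3)[OF \<nu>] by (simp add: E_def)
      also have "(\<integral>x. f x - ?s x \<partial>\<nu>) = integral\<^sup>L \<nu> f - (\<Sum>c\<in>C. f c * integral\<^sup>L \<nu> (\<rho> c))"
        using fi si int(1)[OF \<nu>] by (simp add: Bochner_Integration.integral_sum)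
      finally show ?thesis .
    qed
    have "\<bar>(\<Sum>c\<in>C. f c * integral\<^sup>L (X i) (\<rho> c)) - (\<Sum>c\<in>C. f c * integral\<^sup>L \<mu> (\<rho> c))\<bar> \<le>
        (\<Sum>c\<in>C. \<bar>f c * (integral\<^sup>L (X i) (\<rho> c) - integral\<^sup>L \<mu> (\<rho> c))\<bar>)"
      unfolding sum_subtractf[symmetric] right_diff_distrib[symmetric] by (rule sum_abs)
    also have "\<dots> \<le> (\<Sum>c\<in>C. 1 * \<bar>integral\<^sup>L (X i) (\<rho> c) - integral\<^sup>L \<mu> (\<rho> c)\<bar>)"
      unfolding abs_mult using C0_unit_ballD(3)[OF f] by (intro sum_mono mult_right_mono) auto
    finally show ?thesis using appr[OF X[of i]] appr[OF \<mu>] unfolding integral_gap_def R_def by simp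
  qed
  then have DR: "D_dist l (X i) \<mu> \<le> R i" for i by (rule D_dist_le[OF X \<mu>])
  have "((\<lambda>i. \<integral>x. (1::real) \<partial>X i) \<longlongrightarrow> (\<integral>x. 1 \<partial>\<mu>)) F"
    by (rule narrow_limitD[OF lim, where B = 1]) auto
  then have mass: "((\<lambda>i. mass (X i)) \<longlongrightarrow> mass \<mu>) F"
    unfolding integral_const_finite_borel[OF X] integral_const_finite_borel[OF \<mu>] by simp
  have \<rho>lim: "((\<lambda>i. integral\<^sup>L (X i) (\<rho> c)) \<longlongrightarrow> integral\<^sup>L \<mu> (\<rho> c)) F" if "c \<in> C" for c
    using \<rho>_nonneg \<rho>_le[OF that] by (intro narrow_limitD[OF lim \<rho>c(1), where B = 1]) auto
  have \<rho>0lim: "((\<lambda>i. integral\<^sup>L (X i) \<rho>0) \<longlongrightarrow> integral\<^sup>L \<mu> \<rho>0) F"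
    using \<rho>_nonneg \<rho>0_le by (intro narrow_limitD[OF lim \<rho>c(2), where B = 1]) auto
  have "(R \<longlongrightarrow> E \<mu> + E \<mu> + (\<Sum>c\<in>C. \<bar>integral\<^sup>L \<mu> (\<rho> c) - integral\<^sup>L \<mu> (\<rho> c)\<bar>)) F"
    unfolding R_def E_def by (intro tendsto_intros mass \<rho>lim \<rho>0lim)
  moreover have "E \<mu> + E \<mu> < e"
  proof -
    interpret finite_measure \<mu> by (rule finite_borel_measuresD[OF \<mu>])
    \<comment> \<open>\<open>h\<close> vanishes on the ball, so the remaining weight lives on its
      complement, which has small \<open>\<mu>\<close>-measure by the choice of
      \<open>b\<close>.\<close>
    have "\<rho>0 x \<le> indicator (- cball 0 b) x" for x
      using \<rho>0_le[of x] by (cases "norm x \<le> b") (auto simp: \<rho>0_def h_def)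
    moreover have "integrable \<mu> (indicator (- cball 0 b) :: real^'n \<Rightarrow> real)"
      using finite_borel_measuresD(2)[OF \<mu>] by (simp add: emeasure_eq_measure)
    ultimately have "integral\<^sup>L \<mu> \<rho>0 \<le> (\<integral>x. indicator (- cball 0 b) x \<partial>\<mu>)"
      by (intro integral_mono int0[OF \<mu>]) auto
    also have "\<dots> = measure \<mu> (- cball 0 b)" using finite_borel_measuresD[OF \<mu>] by simp
    finally have "integral\<^sup>L \<mu> \<rho>0 < e / 4" using b by linarith
    then show ?thesis using \<delta>(2) by (simp add: E_def algebra_simps)
  qed
  ultimately have "\<forall>\<^sub>F i in F. R i < e" by (intro order_tendstoD(2)) auto
  then show "\<forall>\<^sub>F i in F. dist (D_dist l (X i) \<mu>) 0 < e"
  proof eventually_elim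
    case (elim i)
    then show ?case using DR[of i] D_dist_nonneg[of l "X i" \<mu>] by simp
  qed
qed

text \<open>Closed sets form an intersection-stable generator, and the indicator of a nonempty
  closed set is the limit of the continuous tents
  \<open>max 0 (1 - k * infdist x A)\<close>.\<close>

lemma finite_borel_measure_eqI:
  fixes \<mu> \<nu> :: "(real^'n::finite) measure"
  assumes \<mu>: "\<mu> \<in> finite_borel_measures" and \<nu>: "\<nu> \<in> finite_borel_measures"
    and eq: "\<And>f :: real^'n \<Rightarrow> real. continuous_on UNIV f \<Longrightarrow> bounded (range f) \<Longrightarrow> integral\<^sup>L \<mu> f = integral\<^sup>L \<nu> f"
  shows "\<mu> = \<nu>"
proof (rule measure_eqI_generator_eq[where E = "Collect closed" and \<Omega> = UNIV and A = "\<lambda>_. UNIV"])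
  show "Int_stable (Collect closed :: (real^'n) set set)" by (auto simp: Int_stable_def)
  show "sets \<mu> = sigma_sets UNIV (Collect closed)" "sets \<nu> = sigma_sets UNIV (Collect closed)"
    using finite_borel_measuresD(2)[OF \<mu>] finite_borel_measuresD(2)[OF \<nu>] by (simp_all add: borel_eq_closed)
  show "emeasure \<mu> UNIV \<noteq> \<infinity>"
    using finite_measure.emeasure_finite[OF finite_borel_measuresD(1)[OF \<mu>]] by simp
  fix A :: "(real^'n) set" assume "A \<in> Collect closed"
  then have A: "closed A" by simp
  show "emeasure \<mu> A = emeasure \<nu> A"
  \<comment> \<open>The distance to the empty set is 0 by convention, so the tents would not tend to
    its indicator.\<close>
  proof (cases "A = {}")
    case False
    define u where "u = (\<lambda>(k::nat) x. max 0 (1 - real k * infdist x A))"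
    have uc: "continuous_on UNIV (u k)" for k unfolding u_def by (intro continuous_intros)
    have u01: "0 \<le> u k x" "u k x \<le> 1" for k x by (auto simp: u_def infdist_nonneg)
    have lim: "(\<lambda>k. u k x) \<longlonglongrightarrow> indicator A x" for x
    proof (cases "x \<in> A")
      case True
      then show ?thesis using False A by (simp add: u_def)
    next
      case x: False
      then have d: "0 < infdist x A" using infdist_pos_not_in_closed[OF A False] by simp
      obtain k where k: "1 / infdist x A < real k" using reals_Archimedean2 by blast
      have "u j x = 0" if "j \<ge> k" for j
      proof -
        have "1 \<le> real j * infdist x A" using k that d
          by (smt (verit) divide_less_eq mult_right_mono of_nat_le_iff)
        then show ?thesis by (simp add: u_def)
      qed
      then show ?thesis using x by (intro tendsto_eventually) (auto simp: eventually_sequentially)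
    qed
    have conv: "(\<lambda>k. integral\<^sup>L \<kappa> (u k)) \<longlonglongrightarrow> measure \<kappa> A" if \<kappa>: "\<kappa> \<in> finite_borel_measures" for \<kappa>
    proof -
      interpret finite_measure \<kappa> by (rule finite_borel_measuresD[OF \<kappa>])
      have se: "sets \<kappa> = sets borel" by (rule finite_borel_measuresD(2)[OF \<kappa>])
      have "u k \<in> borel_measurable \<kappa>" for k
        using borel_measurable_continuous_onI[OF uc] se by (simp cong: measurable_cong_sets)
      then have "(\<lambda>k. integral\<^sup>L \<kappa> (u k)) \<longlonglongrightarrow> (\<integral>x. indicator A x \<partial>\<kappa>)"
        using lim u01 borel_closed[OF A] se by (intro integral_dominated_convergence[where w = "\<lambda>_. 1"]) auto
      then show ?thesis using borel_closed[OF A] se finite_borel_measuresD(3)[OF \<kappa>] by simp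
    qed
    have "bounded (range (u k))" for k using u01[of k] by (auto simp: bounded_iff intro!: exI[of _ 1])
    then have "integral\<^sup>L \<mu> (u k) = integral\<^sup>L \<nu> (u k)" for k by (intro eq uc)
    then have "measure \<mu> A = measure \<nu> A" using conv[OF \<mu>] conv[OF \<nu>] LIMSEQ_unique by fastforce
    then show ?thesis
      using finite_measure.emeasure_eq_measure[OF finite_borel_measuresD(1)[OF \<mu>]]
        finite_measure.emeasure_eq_measure[OF finite_borel_measuresD(1)[OF \<nu>]] by simp
  qed simp
qed auto

text \<open>If the distance is 0, the constant sequence \<open>\<mu>\<close> converges narrowly to
  \<open>\<nu>\<close>; uniqueness of real limits then equates the integrals of all bounded
  continuous functions.\<close>

lemma D_dist_eq_0_iff:
  fixes \<mu> \<nu> :: "(real^'n::finite) measure"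
  assumes \<mu>: "\<mu> \<in> finite_borel_measures" and \<nu>: "\<nu> \<in> finite_borel_measures"
  shows "D_dist l \<mu> \<nu> = 0 \<longleftrightarrow> \<mu> = \<nu>"
proof
  assume "D_dist l \<mu> \<nu> = 0"
  then have "narrow_limit (\<lambda>_::nat. \<mu>) \<nu> sequentially"
    by (intro narrow_limit_if_D_dist_tendsto[where l = l] \<mu> \<nu>) simp
  then have "integral\<^sup>L \<mu> f = integral\<^sup>L \<nu> f" if "continuous_on UNIV f" "bounded (range f)" for f :: "real^'n \<Rightarrow> real"
    using that by (auto simp: narrow_limit_def LIMSEQ_const_iff)
  then show "\<mu> = \<nu>" by (rule finite_borel_measure_eqI[OF \<mu> \<nu>])
next
  assume "\<mu> = \<nu>"
  then have "D_dist l \<mu> \<nu> \<le> 0" by (intro D_dist_le[OF \<mu> \<nu>]) (simp add: integral_gap_def)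
  then show "D_dist l \<mu> \<nu> = 0" using D_dist_nonneg[of l \<mu> \<nu>] by linarith
qed

section \<open>The metric axioms and the topology\<close>

lemma Metric_space_D_dist:
  "Metric_space (finite_borel_measures :: (real^'n::finite) measure set) (D_dist l)"
  by standard (auto simp: D_dist_nonneg D_dist_commute D_dist_eq_0_iff D_dist_triangle)

lemma limitin_D_dist_iff_narrow_limit:
  fixes \<mu> :: "(real^'n::finite) measure"
  assumes X: "\<And>i. X i \<in> finite_borel_measures" and \<mu>: "\<mu> \<in> finite_borel_measures" and "1 \<le> l"
  shows "limitin (Metric_space.mtopology finite_borel_measures (D_dist l)) X \<mu> F \<longleftrightarrow> narrow_limit X \<mu> F"
  using narrow_limit_if_D_dist_tendsto[OF X \<mu>] D_dist_tendsto_if_narrow_limit[OF X \<mu> _ assms(3)] X \<mu>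
  by (auto simp: Metric_space.limitin_metric_dist_null[OF Metric_space_D_dist])

section \<open>Completeness\<close>

text \<open>A vague limit could a priori have lost mass. The Cauchy estimate makes the convergence
  uniform over the test functions, which is convergence in the metric and so excludes the
  loss.\<close>

lemma mcomplete_D_dist:
  "Metric_space.mcomplete (finite_borel_measures :: (real^'n::finite) measure set) (D_dist l)"
proof -
  interpret Metric_space "finite_borel_measures :: (real^'n) measure set" "D_dist l" by (rule Metric_space_D_dist)
  show ?thesis
    unfolding mcomplete_def
  proof (intro allI impI)
    fix \<sigma> :: "nat \<Rightarrow> (real^'n) measure" assume \<sigma>: "MCauchy \<sigma>"
    have M: "\<sigma> k \<in> finite_borel_measures" for k using \<sigma> by (auto simp: MCauchy_def)
    have cauchy: "\<exists>N. \<forall>n\<ge>N. \<forall>m\<ge>N. D_dist l (\<sigma> n) (\<sigma> m) < e" if "0 < e" for e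
    proof -
      obtain N where "\<forall>n m. N \<le> n \<longrightarrow> N \<le> m \<longrightarrow> D_dist l (\<sigma> n) (\<sigma> m) < e"
        using conjunct2[OF \<sigma>[unfolded MCauchy_def]] \<open>0 < e\<close> by metis
      then show ?thesis by (intro exI[of _ N]) simp
    qed
    obtain C where C: "0 < C" "\<forall>\<mu> \<in> finite_borel_measures. \<forall>\<nu> \<in> finite_borel_measures.
      \<bar>mass \<mu> - mass (\<nu> :: (real^'n) measure)\<bar> \<le> C * D_dist l \<mu> \<nu>"
      using mass_difference_le_D_dist .
    have "Cauchy (\<lambda>k. mass (\<sigma> k))"
      unfolding Cauchy_def
    proof (intro allI impI)
      fix e :: real assume "0 < e"
      then obtain N where N: "\<forall>n\<ge>N. \<forall>m\<ge>N. D_dist l (\<sigma> n) (\<sigma> m) < e / C" using cauchy[of "e / C"] C(1) by auto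
      have "dist (mass (\<sigma> m)) (mass (\<sigma> n)) < e" if "m \<ge> N" "n \<ge> N" for m n
      proof -
        have "\<bar>mass (\<sigma> m) - mass (\<sigma> n)\<bar> \<le> C * D_dist l (\<sigma> m) (\<sigma> n)" using C(2) M by simp
        also have "\<dots> < C * (e / C)" using N that C(1) by (intro mult_strict_left_mono) auto
        finally show ?thesis using C(1) by (simp add: dist_real_def)
      qed
      then show "\<exists>N. \<forall>m\<ge>N. \<forall>n\<ge>N. dist (mass (\<sigma> m)) (mass (\<sigma> n)) < e" by blast
    qed
    from cauchy_imp_bounded[OF this] obtain B where B: "\<forall>k. mass (\<sigma> k) \<le> B"
      by (auto simp: bounded_iff)
    obtain r \<mu> where r: "strict_mono (r :: nat \<Rightarrow> nat)" and \<mu>: "\<mu> \<in> finite_borel_measures"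
      and lim: "\<forall>f :: real^'n \<Rightarrow> real. continuous_on UNIV f \<and> (f \<longlongrightarrow> 0) at_infinity \<longrightarrow>
        (\<lambda>k. integral\<^sup>L (\<sigma> (r k)) f) \<longlonglongrightarrow> integral\<^sup>L \<mu> f"
      using vague_compactness[OF M B[rule_format]] .
    have "(\<lambda>n. D_dist l (\<sigma> n) \<mu>) \<longlonglongrightarrow> 0"
      unfolding tendsto_iff
    proof (intro allI impI)
      fix e :: real assume e: "0 < e"
      then obtain N where N: "\<forall>n\<ge>N. \<forall>m\<ge>N. D_dist l (\<sigma> n) (\<sigma> m) < e / 2" using cauchy[of "e / 2"] by auto
      have "D_dist l (\<sigma> n) \<mu> \<le> e / 2" if n: "n \<ge> N" for n
      proof (rule D_dist_le[OF M \<mu>])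
        fix f :: "real^'n \<Rightarrow> real" assume f: "f \<in> C0_unit_ball l"
        \<comment> \<open>With \<open>n\<close> and \<open>f\<close> fixed, the second index goes to
          infinity along the subsequence. The Cauchy bound survives uniformly in \<open>f\<close>,
          and \<open>n\<close> ranges over all large indices, so the whole sequence
          converges.\<close>
        have "(\<lambda>k. integral_gap (\<sigma> n) (\<sigma> (r k)) f) \<longlonglongrightarrow> integral_gap (\<sigma> n) \<mu> f"
          unfolding integral_gap_def using lim C0_unit_ballD[OF f] by (intro tendsto_intros) auto
        moreover have "integral_gap (\<sigma> n) (\<sigma> (r k)) f \<le> e / 2" if "k \<ge> N" for k
        proof -
          have "r k \<ge> N" using that strict_mono_imp_increasing[OF r, of k] by linarith
          then have "D_dist l (\<sigma> n) (\<sigma> (r k)) < e / 2" using N n by simp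
          then show ?thesis using integral_gap_le_D_dist[OF M M f, of n "r k"] by linarith
        qed
        ultimately show "integral_gap (\<sigma> n) \<mu> f \<le> e / 2" by (intro LIMSEQ_le_const2) auto
      qed
      then show "\<forall>\<^sub>F n in sequentially. dist (D_dist l (\<sigma> n) \<mu>) 0 < e"
        using e by (intro eventually_sequentiallyI[of N]) (force simp: D_dist_nonneg)
    qed
    then show "\<exists>\<mu>. limitin mtopology \<sigma> \<mu> sequentially"
      using M \<mu> by (auto simp: limitin_metric_dist_null)
  qed
qed

section \<open>Probability measures\<close>

lemma borel_prob_measures_iff:
  "\<mu> \<in> borel_prob_measures \<longleftrightarrow> \<mu> \<in> finite_borel_measures \<and> mass (\<mu> :: (real^'n::finite) measure) = 1"
proof
  assume "\<mu> \<in> borel_prob_measures"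
  then have p: "prob_space \<mu>" and s: "sets \<mu> = sets borel" by (auto simp: borel_prob_measures_def)
  then show "\<mu> \<in> finite_borel_measures \<and> mass \<mu> = 1"
    using prob_space.prob_space[OF p] sets_eq_imp_space_eq[OF s]
    by (auto simp: finite_borel_measures_def prob_space_def)
next
  assume \<mu>: "\<mu> \<in> finite_borel_measures \<and> mass \<mu> = 1"
  then have "emeasure \<mu> (space \<mu>) = 1"
    using finite_borel_measuresD finite_measure.emeasure_eq_measure by (metis ennreal_1)
  then show "\<mu> \<in> borel_prob_measures"
    using \<mu> by (auto simp: borel_prob_measures_def finite_borel_measures_def intro: prob_spaceI)
qed

lemma Metric_space_prob:
  "Metric_space (borel_prob_measures :: (real^'n::finite) measure set) (D_dist l)"
  by (rule Metric_space.subspace[OF Metric_space_D_dist]) (auto simp: borel_prob_measures_iff)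

text \<open>The probability measures form a closed subset: testing narrow convergence with the
  constant 1 shows that the limit has mass 1.\<close>

lemma mcomplete_prob:
  "Metric_space.mcomplete (borel_prob_measures :: (real^'n::finite) measure set) (D_dist l)"
proof -
  interpret M: Metric_space "finite_borel_measures :: (real^'n) measure set" "D_dist l" by (rule Metric_space_D_dist)
  interpret P: Metric_space "borel_prob_measures :: (real^'n) measure set" "D_dist l" by (rule Metric_space_prob)
  show ?thesis
    unfolding P.mcomplete_def
  proof (intro allI impI)
    fix \<sigma> :: "nat \<Rightarrow> (real^'n) measure" assume \<sigma>: "P.MCauchy \<sigma>"
    have P: "\<sigma> k \<in> borel_prob_measures" for k using \<sigma> by (auto simp: P.MCauchy_def)
    then have M: "\<sigma> k \<in> finite_borel_measures" "mass (\<sigma> k) = 1" for k by (auto simp: borel_prob_measures_iff)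
    have "M.MCauchy \<sigma>" using \<sigma> M by (auto simp: P.MCauchy_def M.MCauchy_def)
    then obtain \<mu> where "limitin M.mtopology \<sigma> \<mu> sequentially"
      using mcomplete_D_dist[where 'n = 'n, of l] unfolding M.mcomplete_def by blast
    then have \<mu>: "\<mu> \<in> finite_borel_measures" "(\<lambda>k. D_dist l (\<sigma> k) \<mu>) \<longlonglongrightarrow> 0"
      by (auto simp: M.limitin_metric_dist_null)
    have "narrow_limit \<sigma> \<mu> sequentially" by (rule narrow_limit_if_D_dist_tendsto[OF M(1) \<mu>])
    then have "(\<lambda>k. \<integral>x. (1::real) \<partial>\<sigma> k) \<longlonglongrightarrow> (\<integral>x. 1 \<partial>\<mu>)" by (rule narrow_limitD[where B = 1]) auto
    then have "mass \<mu> = 1"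
      unfolding integral_const_finite_borel[OF M(1)] integral_const_finite_borel[OF \<mu>(1)] M(2)
      by (simp add: LIMSEQ_const_iff)
    then show "\<exists>\<mu>. limitin P.mtopology \<sigma> \<mu> sequentially"
      using P \<mu> by (auto simp: P.limitin_metric_dist_null borel_prob_measures_iff)
  qed
qed

section \<open>Countable families of test functions\<close>

lemma integral_gap_le_approximation:
  fixes f g :: "real^'n::finite \<Rightarrow> real"
  assumes \<mu>: "\<mu> \<in> finite_borel_measures" and \<nu>: "\<nu> \<in> finite_borel_measures"
    and fg: "f \<in> C0_unit_ball l" "g \<in> C0_unit_ball l" and e: "derivs_bounded l (\<lambda>x. g x - f x) e"
  shows "integral_gap \<mu> \<nu> f \<le> integral_gap \<mu> \<nu> g + e * (mass \<mu> + mass \<nu>)"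
proof -
  have "\<bar>integral\<^sup>L \<kappa> g - integral\<^sup>L \<kappa> f\<bar> \<le> e * mass \<kappa>" if \<kappa>: "\<kappa> \<in> finite_borel_measures" for \<kappa>
  proof -
    interpret finite_measure \<kappa> by (rule finite_borel_measuresD[OF \<kappa>])
    have i: "integrable \<kappa> u" if u: "u \<in> C0_unit_ball l" for u :: "real^'n \<Rightarrow> real"
      by (rule integrable_bounded_continuous[OF \<kappa> C0_unit_ballD(4,3)[OF u]])
    have "\<bar>\<integral>x. g x - f x \<partial>\<kappa>\<bar> \<le> (\<integral>x. e \<partial>\<kappa>)"
      by (rule abs_integral_le[OF \<kappa> Bochner_Integration.integrable_diff[OF i[OF fg(2)] i[OF fg(1)]]
            integrable_const derivs_bounded_abs[OF e]])
    then show ?thesis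
      unfolding integral_const_finite_borel[OF \<kappa>] using i[OF fg(1)] i[OF fg(2)] by simp
  qed
  from this[OF \<mu>] this[OF \<nu>] show ?thesis unfolding integral_gap_def distrib_left by linarith
qed

lemma D_dist_eq_SUP_dense:
  fixes S :: "(real^'n::finite \<Rightarrow> real) set"
  assumes S: "S \<subseteq> C0_unit_ball l"
    and dense: "\<forall>f\<in>C0_unit_ball l. \<forall>e>0. \<exists>g\<in>S. derivs_bounded l (\<lambda>x. g x - f x) e"
    and \<mu>: "\<mu> \<in> finite_borel_measures" and \<nu>: "\<nu> \<in> finite_borel_measures"
  shows "D_dist l \<mu> \<nu> = (SUP f\<in>S. integral_gap \<mu> \<nu> f)"
proof (rule antisym)
  obtain f0 :: "real^'n \<Rightarrow> real" where "f0 \<in> C0_unit_ball l" using C0_unit_ball_nonempty by blast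
  \<comment> \<open>The real supremum over \<open>S\<close> is only estimated from above when
    \<open>S\<close> is nonempty; density near one member of the ball provides an element.\<close>
  then have "S \<noteq> {}" using dense[rule_format, of f0 1] by auto
  have bdd: "bdd_above (integral_gap \<mu> \<nu> ` S)"
    using bdd_above_mono[OF bdd_above_integral_gap[OF \<mu> \<nu>] image_mono[OF S]] .
  show "(SUP f\<in>S. integral_gap \<mu> \<nu> f) \<le> D_dist l \<mu> \<nu>"
    using S by (intro cSUP_least \<open>S \<noteq> {}\<close> integral_gap_le_D_dist \<mu> \<nu>) auto
  show "D_dist l \<mu> \<nu> \<le> (SUP f\<in>S. integral_gap \<mu> \<nu> f)"
  proof (rule D_dist_le[OF \<mu> \<nu>])
    fix f :: "real^'n \<Rightarrow> real" assume f: "f \<in> C0_unit_ball l"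
    show "integral_gap \<mu> \<nu> f \<le> (SUP f\<in>S. integral_gap \<mu> \<nu> f)"
    proof (rule field_le_epsilon)
      fix e :: real assume e: "0 < e"
      define d where "d = e / (1 + (mass \<mu> + mass \<nu>))"
      have m: "0 < 1 + (mass \<mu> + mass \<nu>)" by (simp add: add_pos_nonneg)
      have d: "0 < d" using e m by (simp add: d_def)
      have "d * (mass \<mu> + mass \<nu>) \<le> d * (1 + (mass \<mu> + mass \<nu>))" using d by simp
      also have "\<dots> = e" using m by (simp add: d_def)
      finally have de: "d * (mass \<mu> + mass \<nu>) \<le> e" .
      obtain g where g: "g \<in> S" "derivs_bounded l (\<lambda>x. g x - f x) d" using dense f d by blast
      have "integral_gap \<mu> \<nu> f \<le> integral_gap \<mu> \<nu> g + d * (mass \<mu> + mass \<nu>)"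
        using g S by (intro integral_gap_le_approximation[OF \<mu> \<nu> f]) auto
      also have "\<dots> \<le> (SUP f\<in>S. integral_gap \<mu> \<nu> f) + e"
        using cSUP_upper[OF g(1) bdd] de by (intro add_mono)
      finally show "integral_gap \<mu> \<nu> f \<le> (SUP f\<in>S. integral_gap \<mu> \<nu> f) + e" .
    qed
  qed
qed

text \<open>A member of \<open>S\<close> within \<open>d\<close> of a test function changes
  integrals by at most \<open>d\<close> times the mass, and the masses converge; scaling then passes
  from the unit ball to all of \<open>Cc_space\<close>.\<close>

lemma Cc_space_integral_tendsto:
  fixes S :: "(real^'n::finite \<Rightarrow> real) set"
  assumes S: "S \<subseteq> C0_unit_ball l"
    and dense: "\<forall>f\<in>C0_unit_ball l. \<forall>e>0. \<exists>g\<in>S. derivs_bounded l (\<lambda>x. g x - f x) e"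
    and X: "\<And>i. X i \<in> finite_borel_measures" and \<mu>: "\<mu> \<in> finite_borel_measures"
    and lim: "\<And>g. g \<in> S \<Longrightarrow> ((\<lambda>i. integral\<^sup>L (X i) g) \<longlongrightarrow> integral\<^sup>L \<mu> g) F"
    and mass: "((\<lambda>i. mass (X i)) \<longlongrightarrow> mass \<mu>) F"
    and f: "f \<in> Cc_space l"
  shows "((\<lambda>i. integral\<^sup>L (X i) f) \<longlongrightarrow> integral\<^sup>L \<mu> f) F"
proof -
  have int: "integrable \<nu> u" if "\<nu> \<in> finite_borel_measures" "u \<in> C0_unit_ball l" for \<nu> and u :: "real^'n \<Rightarrow> real"
    by (rule integrable_bounded_continuous[OF that(1) C0_unit_ballD(4,3)[OF that(2)]])
  have ball: "((\<lambda>i. integral\<^sup>L (X i) u) \<longlongrightarrow> integral\<^sup>L \<mu> u) F" if u: "u \<in> C0_unit_ball l" for u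
  proof (rule tendsto_integral_by_approximation[OF X \<mu> int[OF _ u]])
    fix e :: real assume e: "0 < e"
    define d where "d = e / 2 / (1 + mass \<mu>)"
    have M: "0 < 1 + mass \<mu>" by (simp add: add_pos_nonneg)
    have d: "0 < d" using e M by (simp add: d_def)
    have "d * mass \<mu> \<le> d * (1 + mass \<mu>)" using d by simp
    also have "\<dots> = e / 2"
      by (rule iffD1[OF nonzero_eq_divide_eq[OF less_imp_neq[OF M, symmetric]] d_def])
    finally have de: "d * mass \<mu> < e" using e by simp
    obtain g where g: "g \<in> S" "derivs_bounded l (\<lambda>x. g x - u x) d" using dense u d by blast
    have "\<bar>u x - g x\<bar> \<le> d" for x using derivs_bounded_abs[OF g(2), of x] by (simp add: abs_minus_commute)
    moreover have "((\<lambda>i. \<integral>x. d \<partial>X i) \<longlongrightarrow> (\<integral>x. d \<partial>\<mu>)) F"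
      unfolding integral_const_finite_borel[OF X] integral_const_finite_borel[OF \<mu>] by (intro tendsto_intros mass)
    moreover have "integrable \<nu> g" "integrable \<nu> (\<lambda>x. d)" if "\<nu> \<in> finite_borel_measures" for \<nu>
      using int[OF that] g(1) S finite_measure.integrable_const[OF finite_borel_measuresD(1)[OF that]] by auto
    ultimately show "\<exists>g h. (\<forall>\<nu>\<in>finite_borel_measures. integrable \<nu> g \<and> integrable \<nu> h) \<and>
      (\<forall>x. \<bar>u x - g x\<bar> \<le> h x) \<and> ((\<lambda>i. integral\<^sup>L (X i) g) \<longlongrightarrow> integral\<^sup>L \<mu> g) F \<and>
      ((\<lambda>i. integral\<^sup>L (X i) h) \<longlongrightarrow> integral\<^sup>L \<mu> h) F \<and> integral\<^sup>L \<mu> h < e"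
      using lim[OF g(1)] de unfolding integral_const_finite_borel[OF \<mu>, of d, symmetric]
      by - (rule exI[of _ g], rule exI[of _ "\<lambda>x. d"], simp)
  qed
  have f0: "f \<in> C0_space l" using f Cc_space_subset_C0_space by blast
  obtain K where K: "0 < K" "derivs_bounded l f K" using C0_space_bounded[OF f0] .
  let ?a = "num_derivs TYPE('n) l * K"
  have a: "0 < ?a" using K num_derivs_pos[where 'n = 'n] by simp
  have "((\<lambda>i. ?a * (\<integral>x. 1 / ?a * f x \<partial>X i)) \<longlongrightarrow> ?a * (\<integral>x. 1 / ?a * f x \<partial>\<mu>)) F"
    by (intro tendsto_mult_left ball scaled_in_C0_unit_ball f0 K)
  moreover have "?a * (\<integral>x. 1 / ?a * f x \<partial>\<nu>) = integral\<^sup>L \<nu> f" for \<nu>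
    using less_imp_neq[OF a] unfolding integral_mult_right_zero by (simp only: mult.assoc[symmetric]) simp
  ultimately show ?thesis by simp
qed

lemma countable_dense_test_functions:
  obtains S :: "(real^'n::finite \<Rightarrow> real) set" where "countable S" "S \<subseteq> Cc_space l"
    "S \<subseteq> C0_unit_ball l" "S \<noteq> {}"
    "\<forall>f\<in>C0_unit_ball l. \<forall>e>0. \<exists>g\<in>S. derivs_bounded l (\<lambda>x. g x - f x) e"
proof -
  obtain S :: "(real^'n \<Rightarrow> real) set" where S: "countable S" "S \<subseteq> Cc_space l" "\<forall>f\<in>S. C_norm l f \<le> 1"
    "\<forall>f\<in>C0_unit_ball l. \<forall>e>0. \<exists>g\<in>S. derivs_bounded l (\<lambda>x. g x - f x) e"
    using countable_dense_ball .
  obtain f0 :: "real^'n \<Rightarrow> real" where "f0 \<in> C0_unit_ball l" using C0_unit_ball_nonempty by blast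
  then have "S \<noteq> {}" using S(4)[rule_format, of f0 1] by auto
  moreover have "S \<subseteq> C0_unit_ball l"
    using S(2,3) Cc_space_subset_C0_space by (auto simp: C0_unit_ball_def)
  ultimately show ?thesis using that S by blast
qed

text \<open>Integration against a countable dense family embeds the probability measures into the
  separable metric space of real sequences; since masses agree, convergence there is narrow.\<close>

lemma separable_prob:
  assumes l: "1 \<le> l"
  shows "separable_space (Metric_space.mtopology (borel_prob_measures :: (real^'n::finite) measure set) (D_dist l))"
proof -
  interpret P: Metric_space "borel_prob_measures :: (real^'n) measure set" "D_dist l" by (rule Metric_space_prob)
  let ?P = "borel_prob_measures :: (real^'n) measure set"
  obtain S :: "(real^'n \<Rightarrow> real) set" where S: "countable S" "S \<subseteq> Cc_space l"
    "S \<subseteq> C0_unit_ball l" "S \<noteq> {}"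
    "\<forall>f\<in>C0_unit_ball l. \<forall>e>0. \<exists>g\<in>S. derivs_bounded l (\<lambda>x. g x - f x) e"
    using countable_dense_test_functions .
  define \<Phi> where "\<Phi> = (\<lambda>(\<mu> :: (real^'n) measure) k. integral\<^sup>L \<mu> (from_nat_into S k))"
  \<comment> \<open>The countable set is dense in the image and contained in it, so that its points
    have preimages among the probability measures.\<close>
  obtain T where T: "countable T" "T \<subseteq> \<Phi> ` ?P" "\<Phi> ` ?P \<subseteq> closure T" using separable .
  define Q where "Q = inv_into ?P \<Phi> ` T"
  have Q: "countable Q" "Q \<subseteq> ?P" using T(1,2) by (auto simp: Q_def intro: inv_into_into)
  have "\<exists>\<nu>\<in>Q. D_dist l \<mu> \<nu> < r" if \<mu>: "\<mu> \<in> ?P" and "0 < r" for \<mu> r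
  proof -
    have "\<Phi> \<mu> \<in> closure T" using T(3) \<mu> by blast
    then obtain t where t: "\<And>j. t j \<in> T" "t \<longlonglongrightarrow> \<Phi> \<mu>" unfolding closure_sequential by blast
    define \<nu> where "\<nu> = (\<lambda>j::nat. inv_into ?P \<Phi> (t j))"
    have \<nu>Q: "\<nu> j \<in> Q" for j using t(1) by (auto simp: \<nu>_def Q_def)
    then have \<nu>P: "\<nu> j \<in> ?P" for j using Q(2) by blast
    have \<nu>M: "\<nu> j \<in> finite_borel_measures" "mass (\<nu> j) = 1" for j using \<nu>P by (auto simp: borel_prob_measures_iff)
    have \<mu>M: "\<mu> \<in> finite_borel_measures" "mass \<mu> = 1" using \<mu> by (auto simp: borel_prob_measures_iff)
    have \<Phi>\<nu>: "\<Phi> (\<nu> j) = t j" for j unfolding \<nu>_def using T(2) t(1) by (intro f_inv_into_f) auto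
    have lim: "(\<lambda>j. integral\<^sup>L (\<nu> j) g) \<longlonglongrightarrow> integral\<^sup>L \<mu> g" if g: "g \<in> S" for g
    proof -
      obtain k where k: "g = from_nat_into S k" using from_nat_into_surj[OF S(1) g] by blast
      have "continuous_on UNIV (\<lambda>y :: nat \<Rightarrow> real. y k)" by simp
      \<comment> \<open>Sequences carry the product topology: the coordinate maps are continuous, so
        convergence there is convergence of each integral against a member of
        \<open>S\<close>.\<close>
      then have "isCont (\<lambda>y :: nat \<Rightarrow> real. y k) (\<Phi> \<mu>)"
        unfolding continuous_on_eq_continuous_at[OF open_UNIV] by blast
      then have "(\<lambda>j. t j k) \<longlonglongrightarrow> \<Phi> \<mu> k" using t(2) by (rule isCont_tendsto_compose)
      then show ?thesis unfolding \<Phi>\<nu>[symmetric] by (simp add: \<Phi>_def k)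
    qed
    have mass: "(\<lambda>j. mass (\<nu> j)) \<longlonglongrightarrow> mass \<mu>" by (simp add: \<nu>M \<mu>M)
    have "narrow_limit \<nu> \<mu> sequentially"
      by (rule narrow_limit_if_Cc_and_mass[where l = l, OF \<nu>M(1) \<mu>M(1) _ mass])
        (rule Cc_space_integral_tendsto[OF S(3,5) \<nu>M(1) \<mu>M(1) lim mass])
    then have "(\<lambda>j. D_dist l (\<nu> j) \<mu>) \<longlonglongrightarrow> 0"
      by (rule D_dist_tendsto_if_narrow_limit[where X = \<nu>, OF \<nu>M(1) \<mu>M(1) _ l])
    then have "\<forall>\<^sub>F j in sequentially. D_dist l (\<nu> j) \<mu> < r" using \<open>0 < r\<close> by (rule order_tendstoD(2))
    then obtain j where "D_dist l (\<nu> j) \<mu> < r" using eventually_happens'[OF sequentially_bot] by blast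
    then show ?thesis using \<nu>Q D_dist_commute[of l \<mu>] by auto
  qed
  then have "P.mtopology closure_of Q = ?P"
    using Q(2) unfolding P.metric_closure_of by (fastforce simp: P.in_mball)
  then show ?thesis using Q by (auto simp: separable_space_def)
qed

text \<open>The boundedness clause certifies that the real supremum in \<open>D_dist\<close> is a
  genuine one. Convergence is compared along arbitrary filters, which describes the topology and not
  merely its convergent sequences.\<close>

theorem proposition3p2:
  fixes l :: nat
  assumes "l \<ge> 1"
  defines "M \<equiv> finite_borel_measures :: (real^'n::finite) measure set"
  defines "P \<equiv> borel_prob_measures :: (real^'n) measure set"
  shows
    "((\<forall>\<mu>\<in>M. \<forall>\<nu>\<in>M. bdd_above (integral_gap \<mu> \<nu> ` C0_unit_ball l)) \<and>
      Metric_space M (D_dist l)) \<and>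
     (Metric_space.mcomplete M (D_dist l) \<and>
      (\<forall>X :: 'i \<Rightarrow> (real^'n) measure. \<forall>\<mu>\<in>M. \<forall>F :: 'i filter.
         (\<forall>i. X i \<in> M) \<longrightarrow>
           (limitin (Metric_space.mtopology M (D_dist l)) X \<mu> F \<longleftrightarrow> narrow_limit X \<mu> F)) \<and>
      Metric_space P (D_dist l) \<and>
      Metric_space.mcomplete P (D_dist l) \<and>
      separable_space (Metric_space.mtopology P (D_dist l))) \<and>
     (\<exists>S :: (real^'n \<Rightarrow> real) set. countable S \<and> S \<subseteq> Cc_space l \<and>
        (\<forall>\<phi>\<in>S. C_norm l \<phi> \<le> 1) \<and>
        (\<forall>\<psi>\<in>C0_unit_ball l. \<forall>\<epsilon>>0. \<exists>\<phi>\<in>S. C_norm l (\<lambda>x. \<phi> x - \<psi> x) < \<epsilon>) \<and>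
        (\<forall>\<mu>\<in>M. \<forall>\<nu>\<in>M. D_dist l \<mu> \<nu> = (SUP \<phi>\<in>S. integral_gap \<mu> \<nu> \<phi>)))"
proof -
  obtain S :: "(real^'n \<Rightarrow> real) set" where S: "countable S" "S \<subseteq> Cc_space l"
    "S \<subseteq> C0_unit_ball l" "S \<noteq> {}"
    "\<forall>f\<in>C0_unit_ball l. \<forall>e>0. \<exists>g\<in>S. derivs_bounded l (\<lambda>x. g x - f x) e"
    using countable_dense_test_functions .
  have "\<exists>\<phi>\<in>S. C_norm l (\<lambda>x. \<phi> x - \<psi> x) < \<epsilon>" if "\<psi> \<in> C0_unit_ball l" "0 < \<epsilon>" for \<psi> \<epsilon>
  proof -
    have "0 < \<epsilon> / (2 * num_derivs TYPE('n) l)" using that(2) num_derivs_pos[where 'n = 'n] by simp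
    then show ?thesis using S(5) that C_norm_less by blast
  qed
  moreover have "\<forall>\<mu>\<in>M. \<forall>\<nu>\<in>M. D_dist l \<mu> \<nu> = (SUP \<phi>\<in>S. integral_gap \<mu> \<nu> \<phi>)"
    using D_dist_eq_SUP_dense[OF S(3,5)] by (simp add: M_def)
  moreover have "\<forall>\<phi>\<in>S. C_norm l \<phi> \<le> 1" using S(3) by (auto simp: C0_unit_ball_def)
  ultimately have "\<exists>S :: (real^'n \<Rightarrow> real) set. countable S \<and> S \<subseteq> Cc_space l \<and>
        (\<forall>\<phi>\<in>S. C_norm l \<phi> \<le> 1) \<and>
        (\<forall>\<psi>\<in>C0_unit_ball l. \<forall>\<epsilon>>0. \<exists>\<phi>\<in>S. C_norm l (\<lambda>x. \<phi> x - \<psi> x) < \<epsilon>) \<and>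
        (\<forall>\<mu>\<in>M. \<forall>\<nu>\<in>M. D_dist l \<mu> \<nu> = (SUP \<phi>\<in>S. integral_gap \<mu> \<nu> \<phi>))"
    using S(1,2) by (intro exI[of _ S]) simp
  then show ?thesis
    unfolding M_def P_def
    by (intro conjI ballI allI impI bdd_above_integral_gap Metric_space_D_dist mcomplete_D_dist
        Metric_space_prob mcomplete_prob separable_prob[OF assms(1)]
        limitin_D_dist_iff_narrow_limit[OF _ _ assms(1)]) auto
qed

end
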